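(* Let $\ell\in\mathbb{Z}_+$. For an $r$-rooted $(\ell+1)$-arc-connected digraph $D$, an arc-$\ell$-color-avoiding $r$-rooted 1-connected coloring of $D$ with $\ell+1$ colors can be found in polynomial time.
   Context: Digraphs may have loops and parallel arcs. A digraph with vertex $r$ is $r$-rooted $k$-arc-connected if it has at least two vertices and there are at least $k$ pairwise arc-disjoint dipaths from $r$ to every other vertex, or if it is a one-vertex digraph with at least $k$ loops. An arc-coloring $f\colon E(D)\to C$ ($C$ finite) is arc-$\ell$-color-avoiding $r$-rooted 1-connected if for every $C'\subseteq C$ with $|C'|\le\ell$, after deleting all arcs whose color lies in $C'$, every vertex is still reachable from $r$ by a dipath. *)

theory Defs
  imports
    "Graph_Theory.Digraph"
    "Graph_Theory.Arc_Walk"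
    "HOL-Computational_Algebra.Polynomial"
begin

section \<open>Rooted arc-connectivity and color-avoiding colorings\<close>

text \<open>The records of type \<open>pre_digraph\<close> allow loops and parallel arcs. A dipath is an
  \<open>apath\<close>: a list of arcs forming a directed walk without repeated vertices.\<close>

definition rooted_arc_connected :: "nat \<Rightarrow> ('a, 'b) pre_digraph \<Rightarrow> 'a \<Rightarrow> bool" where
  "rooted_arc_connected k D r \<longleftrightarrow> r \<in> verts D \<and>
     (card (verts D) \<ge> 2 \<and>
        (\<forall>v \<in> verts D - {r}. \<exists>P. finite P \<and> card P \<ge> k \<and>
           (\<forall>p \<in> P. pre_digraph.apath D r p v) \<and>
           pairwise (\<lambda>p q. set p \<inter> set q = {}) P)
      \<or> card (verts D) = 1 \<and> card {e \<in> arcs D. tail D e = head D e} \<ge> k)"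

definition arc_color_avoiding_rooted_1_connected ::
    "nat \<Rightarrow> ('a, 'b) pre_digraph \<Rightarrow> 'a \<Rightarrow> 'c set \<Rightarrow> ('b \<Rightarrow> 'c) \<Rightarrow> bool" where
  "arc_color_avoiding_rooted_1_connected l D r C f \<longleftrightarrow>
     finite C \<and> f ` arcs D \<subseteq> C \<and>
     (\<forall>C' \<subseteq> C. card C' \<le> l \<longrightarrow>
        (\<forall>v \<in> verts D. \<exists>p. pre_digraph.apath (D\<lparr>arcs := {e \<in> arcs D. f e \<notin> C'}\<rparr>) r p v))"


section \<open>Random access machine programs and their running time\<close>

text \<open>The machine has finitely many named arrays (those occurring in the program) of
  natural-number cells, accessed by computed indices; a scalar variable is cell 0 of an array.
  Running time is the number of elementary operations. Addition and truncated subtraction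
  are the only arithmetic operations, so that the bit length of a cell grows by at most a
  constant per step and polynomial time on this machine agrees with polynomial time on a
  Turing machine. With a unit-cost multiplication that would fail.\<close>

type_synonym store = "string \<Rightarrow> nat \<Rightarrow> nat"

datatype aexp = Const nat | Cell string aexp | Plus aexp aexp | Minus aexp aexp

datatype bexp = Less aexp aexp | Equal aexp aexp | Neg bexp | Conj bexp bexp

datatype com =
    Skip
  | Assign string aexp aexp  \<comment> \<open>array, index, value\<close>
  | Seq com com
  | Cond bexp com com
  | While bexp com

primrec aval :: "aexp \<Rightarrow> store \<Rightarrow> nat" where
  "aval (Const n) s = n"
| "aval (Cell x a) s = s x (aval a s)"
| "aval (Plus a b) s = aval a s + aval b s"
| "aval (Minus a b) s = aval a s - aval b s"

primrec bval :: "bexp \<Rightarrow> store \<Rightarrow> bool" where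
  "bval (Less a b) s \<longleftrightarrow> aval a s < aval b s"
| "bval (Equal a b) s \<longleftrightarrow> aval a s = aval b s"
| "bval (Neg b) s \<longleftrightarrow> \<not> bval b s"
| "bval (Conj b c) s \<longleftrightarrow> bval b s \<and> bval c s"

primrec acost :: "aexp \<Rightarrow> nat" where
  "acost (Const n) = 1"
| "acost (Cell x a) = 1 + acost a"
| "acost (Plus a b) = 1 + acost a + acost b"
| "acost (Minus a b) = 1 + acost a + acost b"

primrec bcost :: "bexp \<Rightarrow> nat" where
  "bcost (Less a b) = 1 + acost a + acost b"
| "bcost (Equal a b) = 1 + acost a + acost b"
| "bcost (Neg b) = 1 + bcost b"
| "bcost (Conj b c) = 1 + bcost b + bcost c"

text \<open>\<open>exec c s t s'\<close>: started in store \<open>s\<close>, program \<open>c\<close> halts after exactly \<open>t\<close> operations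
  in store \<open>s'\<close>.\<close>

inductive exec :: "com \<Rightarrow> store \<Rightarrow> nat \<Rightarrow> store \<Rightarrow> bool" where
  Skip: "exec Skip s 1 s"
| Assign: "exec (Assign x a b) s (1 + acost a + acost b)
             (s(x := (s x)(aval a s := aval b s)))"
| Seq: "exec c1 s t1 s1 \<Longrightarrow> exec c2 s1 t2 s2 \<Longrightarrow> exec (Seq c1 c2) s (t1 + t2) s2"
| CondTrue: "bval b s \<Longrightarrow> exec c1 s t s' \<Longrightarrow> exec (Cond b c1 c2) s (bcost b + t) s'"
| CondFalse: "\<not> bval b s \<Longrightarrow> exec c2 s t s' \<Longrightarrow> exec (Cond b c1 c2) s (bcost b + t) s'"
| WhileFalse: "\<not> bval b s \<Longrightarrow> exec (While b c) s (bcost b) s"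
| WhileTrue: "bval b s \<Longrightarrow> exec c s t1 s1 \<Longrightarrow> exec (While b c) s1 t2 s2 \<Longrightarrow>
             exec (While b c) s (bcost b + t1 + t2) s2"

inductive_cases SkipE: "exec Skip s t s'"
inductive_cases AssignE: "exec (Assign x a b) s t s'"
inductive_cases SeqE: "exec (Seq c1 c2) s t s'"
inductive_cases CondE: "exec (Cond b c1 c2) s t s'"
inductive_cases WhileE: "exec (While b c) s t s'"

lemma exec_deterministic:
  "exec c s t s' \<Longrightarrow> exec c s u s'' \<Longrightarrow> u = t \<and> s'' = s'"
proof (induction arbitrary: u s'' rule: exec.induct)
  case (Skip s)
  then show ?case by (rule SkipE) simp
next
  case (Assign x a b s)
  then show ?case by (rule AssignE) simp
next
  case (Seq c1 s t1 s1 c2 t2 s2)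
  from Seq.prems show ?case by (rule SeqE) (use Seq.IH in blast)
next
  case (CondTrue b s c1 t s' c2)
  from CondTrue.prems show ?case by (rule CondE) (use CondTrue.IH CondTrue.hyps(1) in blast)+
next
  case (CondFalse b s c2 t s' c1)
  from CondFalse.prems show ?case by (rule CondE) (use CondFalse.IH CondFalse.hyps(1) in blast)+
next
  case (WhileFalse b s c)
  from WhileFalse.prems show ?case by (rule WhileE) (use WhileFalse.hyps in blast)+
next
  case (WhileTrue b s c t1 s1 t2 s2)
  from WhileTrue.prems show ?case by (rule WhileE) (use WhileTrue.IH WhileTrue.hyps(1) in blast)+
qed


section \<open>Digraphs as machine input\<close>

text \<open>A digraph is presented to the machine with its vertices and its arcs numbered
  consecutively from 0, every arc being given by its tail and its head.\<close>

definition numbered_digraph :: "(nat, nat) pre_digraph \<Rightarrow> bool" where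
  "numbered_digraph D \<longleftrightarrow> fin_digraph D \<and>
     verts D = {..<card (verts D)} \<and> arcs D = {..<card (arcs D)}"

definition scalar :: "nat \<Rightarrow> nat \<Rightarrow> nat" where
  "scalar a = (\<lambda>_. 0)(0 := a)"

definition input_store :: "nat \<Rightarrow> (nat, nat) pre_digraph \<Rightarrow> nat \<Rightarrow> store" where
  "input_store l D r = (\<lambda>_ _. 0)
     (''vertices'' := scalar (card (verts D)),
      ''arcs'' := scalar (card (arcs D)),
      ''root'' := scalar r,
      ''level'' := scalar l,
      ''tail'' := (\<lambda>e. if e \<in> arcs D then tail D e else 0),
      ''head'' := (\<lambda>e. if e \<in> arcs D then head D e else 0))"

text \<open>The output is the array \<open>''color''\<close>, whose cell \<open>e\<close> holds the color of arc \<open>e\<close>.\<close>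

definition output_coloring :: "store \<Rightarrow> nat \<Rightarrow> nat" where
  "output_coloring s = s ''color''"

definition digraph_size :: "('a, 'b) pre_digraph \<Rightarrow> nat" where
  "digraph_size D = card (verts D) + card (arcs D)"

end

theory Submission
  imports Defs
begin

text \<open>Deleting \<open>l\<close> of \<open>l + 1\<close> colors may leave any single color class, so every class has to contain
  a spanning arborescence: this is Edmonds' theorem on packing arborescences, and Lovasz's
  proof of it is made algorithmic. The classes are grown one after the other from \<open>r\<close>. For color
  \<open>i\<close>, an uncolored arc \<open>e\<close> leaving the set \<open>X\<close> reached so far is accepted if, without \<open>e\<close>, at least
  \<open>l - i\<close> uncolored arcs still enter every vertex set that contains the head of \<open>e\<close> but not \<open>r\<close>; a
  submodularity argument provides such an arc as long as \<open>X\<close> is not everything. The test is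
  a maximum flow computation in which augmenting is reversing the arcs of a path from \<open>r\<close> to
  the head of \<open>e\<close>: each reversal lowers the in-degree of each of these sets by exactly 1, and if no
  path is left then the set of unreachable vertices has in-degree 0.\<close>

section \<open>Cuts\<close>

text \<open>Tail and head are plain function arguments because the flow computation reverses arcs in
  working copies of both arrays, and the same cuts are compared before and after.\<close>

definition indeg :: "('b \<Rightarrow> 'a) \<Rightarrow> ('b \<Rightarrow> 'a) \<Rightarrow> 'b set \<Rightarrow> 'a set \<Rightarrow> nat" where
  "indeg t h E U = card {e \<in> E. t e \<notin> U \<and> h e \<in> U}"

lemma indeg_sum: "finite E \<Longrightarrow> indeg t h E U = (\<Sum>e\<in>E. of_bool (t e \<notin> U \<and> h e \<in> U))"
  by (simp add: indeg_def Int_def)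

text \<open>Submodularity already holds for the indicator of each single arc; the slack counts the
  arcs from \<open>A - B\<close> to \<open>B - A\<close>.\<close>

lemma indeg_submodular:
  assumes "finite E"
  shows "indeg t h E (A \<inter> B) + indeg t h E (A \<union> B) \<le> indeg t h E A + indeg t h E B"
  unfolding indeg_sum[OF assms] sum.distrib[symmetric] by (rule sum_mono) auto

text \<open>Only the summand of \<open>p\<close> changes, and it changes by the difference of the
  two indicators shown. These differences telescope along a path. A term is added on each side to
  avoid truncated subtraction.\<close>

lemma indeg_reverse_arc:
  assumes "finite E" "p \<in> E"
  shows "indeg (t(p := h p)) (h(p := t p)) E U + of_bool (t p \<notin> U)
    = indeg t h E U + of_bool (h p \<notin> U)"
proof -
  have "(\<Sum>e\<in>E - {p}. of_bool ((t(p := h p)) e \<notin> U \<and> (h(p := t p)) e \<in> U))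
      = (\<Sum>e\<in>E - {p}. of_bool (t e \<notin> U \<and> h e \<in> U) :: nat)"
    by (rule sum.cong) auto
  then show ?thesis
    unfolding indeg_sum[OF assms(1)] sum.remove[OF assms] by auto
qed

lemma indeg_remove_arc:
  assumes "finite E" "e \<in> E"
  shows "indeg t h E U = indeg t h (E - {e}) U + of_bool (t e \<notin> U \<and> h e \<in> U)"
  unfolding indeg_sum[OF assms(1)] indeg_sum[OF finite_Diff[OF assms(1)]] sum.remove[OF assms]
  by simp

text \<open>Lovasz's exchange step: among the sets of minimum in-degree that stick out of \<open>X\<close>, take
  an inclusion-minimal one \<open>U\<close>. More arcs enter \<open>U - X\<close> than \<open>U\<close>, so one of them starts in
  \<open>U \<inter> X\<close>; a set of minimum in-degree entered by it would, by submodularity, intersect \<open>U\<close> in a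
  smaller such set.\<close>

lemma exchange_arc:
  fixes X V :: "'a set"
  assumes E: "finite E" and ends: "\<forall>e\<in>E. t e \<in> V \<and> h e \<in> V"
    and V: "finite V" "X \<subseteq> V" "X \<noteq> V" "r \<in> X"
    and all: "\<And>U. U \<noteq> {} \<Longrightarrow> U \<subseteq> V \<Longrightarrow> r \<notin> U \<Longrightarrow> k \<le> indeg t h E U"
    and outside: "\<And>U. U \<noteq> {} \<Longrightarrow> U \<subseteq> V \<Longrightarrow> U \<inter> X = {} \<Longrightarrow> k < indeg t h E U"
  obtains e where "e \<in> E" "t e \<in> X" "h e \<notin> X"
    "\<And>U. U \<subseteq> V \<Longrightarrow> h e \<in> U \<Longrightarrow> r \<notin> U \<Longrightarrow> k \<le> indeg t h (E - {e}) U"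
proof -
  define tight where "tight U \<longleftrightarrow> U \<subseteq> V \<and> r \<notin> U \<and> indeg t h E U = k" for U
  have "\<exists>e\<in>E. t e \<in> X \<and> h e \<notin> X \<and> (\<forall>W. tight W \<longrightarrow> h e \<in> W \<longrightarrow> t e \<in> W)"
  proof (cases "\<exists>U. tight U \<and> \<not> U \<subseteq> X")
    case False
    \<comment> \<open>Every tight set lies in \<open>X\<close>, so the head of an arc entering
      \<open>V - X\<close> is in none of them. Since \<open>V - X\<close> misses \<open>X\<close>,
      such an arc exists.\<close>
    have "0 < indeg t h E (V - X)"
      using outside[of "V - X"] V by (simp add: Int_commute Diff_eq_empty_iff)
    then have "{e \<in> E. t e \<notin> V - X \<and> h e \<in> V - X} \<noteq> {}"
      unfolding indeg_def by (intro notI) (simp only: card.empty less_irrefl)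
    then obtain e where e: "e \<in> E" "t e \<notin> V - X" "h e \<in> V - X" by auto
    with ends False show ?thesis by blast
  next
    case True
    then obtain U where U: "tight U" "\<not> U \<subseteq> X"
      and min: "\<And>W. tight W \<Longrightarrow> \<not> W \<subseteq> X \<Longrightarrow> card U \<le> card W"
      using ex_has_least_nat[of "\<lambda>U. tight U \<and> \<not> U \<subseteq> X" _ card] by blast
    from U have "indeg t h E U < indeg t h E (U - X)"
      using outside[of "U - X"] by (auto simp: tight_def)
    then have "\<not> {e \<in> E. t e \<notin> U - X \<and> h e \<in> U - X} \<subseteq> {e \<in> E. t e \<notin> U \<and> h e \<in> U}"
      using card_mono[of "{e \<in> E. t e \<notin> U \<and> h e \<in> U}"] E by (auto simp: indeg_def not_le[symmetric])
    then obtain e where e: "e \<in> E" "t e \<in> U \<inter> X" "h e \<in> U - X" by auto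
    have "t e \<in> W" if W: "tight W" "h e \<in> W" for W
    proof (rule ccontr)
      assume te: "t e \<notin> W"
      have "k \<le> indeg t h E (U \<inter> W)" "k \<le> indeg t h E (U \<union> W)"
        using W U e by (intro all; auto simp: tight_def)+
      then have "tight (U \<inter> W)"
        using indeg_submodular[OF E, of t h U W] W U by (auto simp: tight_def)
      moreover have "\<not> U \<inter> W \<subseteq> X" using e W by auto
      ultimately have "card U \<le> card (U \<inter> W)" by (rule min)
      moreover have "card (U \<inter> W) < card U"
        using e te U V by (intro psubset_card_mono) (auto simp: tight_def intro: finite_subset)
      ultimately show False by simp
    qed
    with e show ?thesis by blast
  qed
  then obtain e where e: "e \<in> E" "t e \<in> X" "h e \<notin> X"
    and tight: "\<And>W. tight W \<Longrightarrow> h e \<in> W \<Longrightarrow> t e \<in> W" by blast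
  \<comment> \<open>A tight set around \<open>h e\<close> also contains \<open>t e\<close> and keeps
    its in-degree; any other set has an arc to spare.\<close>
  have "k \<le> indeg t h (E - {e}) U" if U: "U \<subseteq> V" "h e \<in> U" "r \<notin> U" for U
  proof -
    have "k \<le> indeg t h E U" using U by (intro all) auto
    moreover have "t e \<in> U" if "k = indeg t h E U"
      using tight[of U] U that by (simp add: tight_def)
    ultimately show ?thesis
      using indeg_remove_arc[OF E e(1), of t h U] U(2) by (cases "t e \<in> U") (auto simp: le_Suc_eq)
  qed
  with e that show thesis by blast
qed

section \<open>From arc-disjoint dipaths to cuts and back to dipaths\<close>

lemma (in wf_digraph) awalk_enters:
  assumes "awalk u p v" "u \<notin> U" "v \<in> U"
  shows "\<exists>e \<in> set p. e \<in> arcs G \<and> tail G e \<notin> U \<and> head G e \<in> U"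
  using assms
proof (induction p arbitrary: u)
  case Nil
  then show ?case by (simp add: awalk_Nil_iff)
next
  case (Cons e p)
  then show ?case by (cases "head G e \<in> U") (auto simp: awalk_Cons_iff)
qed

text \<open>The easy half of Menger's theorem: each dipath to a fixed vertex of \<open>U\<close>
  enters \<open>U\<close>, and disjoint dipaths enter it by different arcs.\<close>

lemma rooted_arc_connected_indeg:
  assumes "fin_digraph D" "rooted_arc_connected k D r" "U \<noteq> {}" "U \<subseteq> verts D" "r \<notin> U"
  shows "k \<le> indeg (tail D) (head D) (arcs D) U"
proof -
  interpret fin_digraph D by fact
  obtain v where v: "v \<in> U" using assms by auto
  have "r \<in> verts D" using assms by (auto simp: rooted_arc_connected_def)
  then have "{r, v} \<subseteq> verts D" "r \<noteq> v" using v assms by auto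
  \<comment> \<open>The two vertices \<open>r\<close> and \<open>v\<close> rule out the alternative
    of the definition that counts loops.\<close>
  then have "card (verts D) \<noteq> 1" using card_mono[of "verts D" "{r, v}"] by auto
  then obtain P where P: "finite P" "k \<le> card P" "\<forall>p \<in> P. apath r p v"
      "pairwise (\<lambda>p q. set p \<inter> set q = {}) P"
    using assms(2) v assms(4,5) unfolding rooted_arc_connected_def by blast
  have "\<forall>p\<in>P. \<exists>e. e \<in> set p \<and> e \<in> arcs D \<and> tail D e \<notin> U \<and> head D e \<in> U"
    using P(3) awalk_enters[OF awalkI_apath] v assms(5) by blast
  then obtain g where g: "\<And>p. p \<in> P \<Longrightarrow> g p \<in> set p \<and> g p \<in> arcs D \<and> tail D (g p) \<notin> U \<and> head D (g p) \<in> U"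
    by metis
  have "inj_on g P"
  proof (rule inj_onI)
    fix p q assume "p \<in> P" "q \<in> P" "g p = g q"
    then have "g p \<in> set p \<inter> set q" using g[of p] g[of q] by auto
    with \<open>p \<in> P\<close> \<open>q \<in> P\<close> P(4) show "p = q" by (auto simp: pairwise_def)
  qed
  then have "card P \<le> indeg (tail D) (head D) (arcs D) U"
    unfolding indeg_def using g by (intro card_inj_on_le[of g]) auto
  with P(2) show ?thesis by simp
qed

text \<open>The invariants below express reachability by a reflexive transitive closure, which is
  monotone in the set of arcs; this lemma recovers dipaths at the end.\<close>

lemma (in wf_digraph) rtrancl_imp_apath:
  assumes "(r, v) \<in> {(tail G e, head G e) |e. e \<in> arcs G}\<^sup>*" "r \<in> verts G"
  shows "\<exists>p. apath r p v"
proof -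
  from assms have "\<exists>p. awalk r p v"
  proof (induction rule: rtrancl_induct)
    case base
    then have "awalk r [] r" by (simp add: awalk_Nil_iff)
    then show ?case by blast
  next
    case (step y z)
    then show ?case using arc_implies_awalk awalk_appendI by blast
  qed
  then show ?thesis using apath_awalk_to_apath by blast
qed

section \<open>Time-bounded execution\<close>

text \<open>A total-correctness judgement with an upper bound on the time. Since \<open>exec\<close>
  is deterministic, the execution asserted to exist is the only one.\<close>

definition run :: "com \<Rightarrow> store \<Rightarrow> nat \<Rightarrow> (store \<Rightarrow> bool) \<Rightarrow> bool" where
  "run c s T Q \<longleftrightarrow> (\<exists>u s'. exec c s u s' \<and> u \<le> T \<and> Q s')"

primrec mods :: "com \<Rightarrow> string set" where
  "mods Skip = {}"
| "mods (Assign x a b) = {x}"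
| "mods (Seq c d) = mods c \<union> mods d"
| "mods (Cond b c d) = mods c \<union> mods d"
| "mods (While b c) = mods c"

definition agree_off :: "string set \<Rightarrow> store \<Rightarrow> store \<Rightarrow> bool" where
  "agree_off A s s' \<longleftrightarrow> (\<forall>x. x \<notin> A \<longrightarrow> s' x = s x)"

lemma exec_agree_off: "exec c s u s' \<Longrightarrow> agree_off (mods c) s s'"
  by (induction rule: exec.induct) (auto simp: agree_off_def)

text \<open>A consequence rule with a built-in frame: the new postcondition may use that every array
  outside \<open>mods c\<close> is unchanged, so specifications mention only what a program
  alters.\<close>

lemma run_weaken:
  assumes "run c s T Q" "T \<le> T'" "\<And>s'. agree_off (mods c) s s' \<Longrightarrow> Q s' \<Longrightarrow> Q' s'"
  shows "run c s T' Q'"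
  using assms exec_agree_off unfolding run_def by (blast intro: le_trans)

lemma run_Seq:
  assumes "run c s T Q" "\<And>s'. agree_off (mods c) s s' \<Longrightarrow> Q s' \<Longrightarrow> run d s' T' Q'"
    "T + T' \<le> T''"
  shows "run (Seq c d) s T'' Q'"
proof -
  obtain u s' where 1: "exec c s u s'" "u \<le> T" "Q s'" using assms(1) by (auto simp: run_def)
  then obtain u' s'' where "exec d s' u' s''" "u' \<le> T'" "Q' s''"
    using assms(2) exec_agree_off unfolding run_def by blast
  with exec.Seq[OF 1(1)] 1(2) assms(3) show ?thesis
    unfolding run_def by (intro exI[of _ "u + u'"] exI[of _ s'']) simp
qed

lemma run_Cond:
  assumes "bval b s \<Longrightarrow> run c s T Q" "\<not> bval b s \<Longrightarrow> run d s T Q" "bcost b + T \<le> T'"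
  shows "run (Cond b c d) s T' Q"
proof (cases "bval b s")
  case True
  then obtain u s' where "exec c s u s'" "u \<le> T" "Q s'" using assms(1) by (auto simp: run_def)
  with exec.CondTrue[OF True] assms(3) show ?thesis
    unfolding run_def by (intro exI[of _ "bcost b + u"] exI[of _ s']) simp
next
  case False
  then obtain u s' where "exec d s u s'" "u \<le> T" "Q s'" using assms(2) by (auto simp: run_def)
  with exec.CondFalse[OF False] assms(3) show ?thesis
    unfolding run_def by (intro exI[of _ "bcost b + u"] exI[of _ s']) simp
qed

section \<open>Loop-free programs, executed symbolically\<close>

primrec loop_free :: "com \<Rightarrow> bool" where
  "loop_free Skip = True"
| "loop_free (Assign x a b) = True"
| "loop_free (Seq c d) = (loop_free c \<and> loop_free d)"
| "loop_free (Cond b c d) = (loop_free c \<and> loop_free d)"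
| "loop_free (While b c) = False"

primrec final_store :: "com \<Rightarrow> store \<Rightarrow> store" where
  "final_store Skip s = s"
| "final_store (Assign x a b) s = s(x := (s x)(aval a s := aval b s))"
| "final_store (Seq c d) s = final_store d (final_store c s)"
| "final_store (Cond b c d) s = (if bval b s then final_store c s else final_store d s)"
| "final_store (While b c) s = s"

text \<open>Both branches of a conditional are added up instead of taking their maximum, which keeps
  the bound a plain sum. The clause for \<open>While\<close> is a dummy, as it is in
  \<open>final_store\<close>.\<close>

primrec cost_bound :: "com \<Rightarrow> nat" where
  "cost_bound Skip = 1"
| "cost_bound (Assign x a b) = 1 + acost a + acost b"
| "cost_bound (Seq c d) = cost_bound c + cost_bound d"
| "cost_bound (Cond b c d) = bcost b + (cost_bound c + cost_bound d)"
| "cost_bound (While b c) = 0"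

lemma run_loop_free:
  assumes "loop_free c" "cost_bound c \<le> T" "Q (final_store c s)"
  shows "run c s T Q"
proof -
  have "loop_free c \<Longrightarrow> \<exists>u \<le> cost_bound c. exec c s u (final_store c s)"
  proof (induction c arbitrary: s)
    case Skip
    then show ?case using exec.Skip[of s] by auto
  next
    case (Assign x a b)
    have "exec (Assign x a b) s (cost_bound (Assign x a b)) (final_store (Assign x a b) s)"
      using exec.Assign[of x a b s] by simp
    then show ?case by blast
  next
    case (Seq c d)
    then obtain u v where "u \<le> cost_bound c" "exec c s u (final_store c s)"
      "v \<le> cost_bound d" "exec d (final_store c s) v (final_store d (final_store c s))"
      by fastforce
    then have "exec (Seq c d) s (u + v) (final_store (Seq c d) s)" "u + v \<le> cost_bound (Seq c d)"
      using exec.Seq[of c s u _ d v] by simp_all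
    then show ?case by blast
  next
    case (Cond b c d)
    then obtain u v where "u \<le> cost_bound c" "exec c s u (final_store c s)"
      "v \<le> cost_bound d" "exec d s v (final_store d s)"
      by fastforce
    then have "exec (Cond b c d) s (if bval b s then bcost b + u else bcost b + v)
        (final_store (Cond b c d) s)"
      using exec.CondTrue[of b s c u _ d] exec.CondFalse[of b s d v _ c] by simp
    moreover have "(if bval b s then bcost b + u else bcost b + v) \<le> cost_bound (Cond b c d)"
      using \<open>u \<le> _\<close> \<open>v \<le> _\<close> by simp
    ultimately show ?case by blast
  next
    case (While b c)
    then show ?case by simp
  qed
  with assms show ?thesis unfolding run_def by (blast intro: le_trans)
qed

section \<open>Counted loops\<close>

abbreviation Var :: "string \<Rightarrow> aexp" where
  "Var x \<equiv> Cell x (Const 0)"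

abbreviation Set_Var :: "string \<Rightarrow> aexp \<Rightarrow> com" where
  "Set_Var x \<equiv> Assign x (Const 0)"

definition For :: "string \<Rightarrow> aexp \<Rightarrow> com \<Rightarrow> com" where
  "For x b c = Seq (Set_Var x (Const 0))
     (While (Less (Var x) b) (Seq c (Set_Var x (Plus (Var x) (Const 1)))))"

lemma mods_For [simp]: "mods (For x b c) = insert x (mods c)"
  by (auto simp: For_def)

text \<open>A round pays for the body, a test of cost at most 12 (if the bound expression costs at
  most 9) and an increment of cost 6; the final 20 covers the initialization and the failing test.
  One common bound \<open>z\<close> for all loops makes every cost a polynomial in a single
  variable.\<close>

definition for_cost :: "nat \<Rightarrow> nat \<Rightarrow> nat" where
  "for_cost z T = z * (T + 20) + 20"

text \<open>The invariant \<open>J\<close> may not depend on the loop counter cell (hypothesis \<open>counter\<close>); what the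
  loop body does not modify need not be mentioned in it.\<close>

lemma run_For:
  assumes x: "x \<notin> mods c"
    and N: "\<And>s'. agree_off (insert x (mods c)) s s' \<Longrightarrow> aval b s' = N"
    and init: "J 0 s"
    and counter: "\<And>j s' f. J j s' \<Longrightarrow> J j (s'(x := f))"
    and step: "\<And>j s'. j < N \<Longrightarrow> s' x 0 = j \<Longrightarrow> J j s' \<Longrightarrow> agree_off (insert x (mods c)) s s' \<Longrightarrow>
        run c s' T (J (Suc j))"
    and final: "\<And>s'. J N s' \<Longrightarrow> agree_off (insert x (mods c)) s s' \<Longrightarrow> Q s'"
    and T': "N \<le> z" "acost b \<le> 9" "for_cost z T \<le> T'"
  shows "run (For x b c) s T' Q"
proof -
  let ?b = "Less (Var x) b"
  let ?c = "Seq c (Set_Var x (Plus (Var x) (Const 1)))"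
  let ?w = "While ?b ?c"
  \<comment> \<open>Here \<open>k\<close> is the number of rounds still to come, and 12 pays for the
    last test.\<close>
  have loop: "run ?w s' (k * (T + 20) + 12) (\<lambda>s'. J N s' \<and> agree_off (insert x (mods c)) s s')"
    if "s' x 0 = j" "J j s'" "agree_off (insert x (mods c)) s s'" "j + k = N" for j k s'
    using that
  proof (induction k arbitrary: j s')
    case 0
    then have "\<not> bval ?b s'" using N by simp
    then have "exec ?w s' (bcost ?b) s'" by (rule exec.WhileFalse)
    with 0 T' show ?case unfolding run_def by (force intro!: exI[of _ "bcost ?b"] exI[of _ s'])
  next
    case (Suc k)
    then have b: "bval ?b s'" using N by simp
    from Suc have "run c s' T (J (Suc j))" by (intro step) auto
    then obtain u s1 where c: "exec c s' u s1" and u: "u \<le> T" "J (Suc j) s1"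
      by (auto simp: run_def)
    let ?s2 = "s1(x := (s1 x)(0 := s1 x 0 + 1))"
    have c': "exec ?c s' (u + 6) ?s2"
      using exec.Seq[OF c exec.Assign[of x "Const 0" "Plus (Var x) (Const 1)" s1]]
      by (simp add: numeral_eq_Suc)
    have agree: "agree_off (mods c) s' s1" using c by (rule exec_agree_off)
    with Suc.prems x have s2: "?s2 x 0 = Suc j" "J (Suc j) ?s2" "agree_off (insert x (mods c)) s ?s2"
      using u counter by (auto simp: agree_off_def)
    have "run ?w ?s2 (k * (T + 20) + 12) (\<lambda>s'. J N s' \<and> agree_off (insert x (mods c)) s s')"
      by (rule Suc.IH[OF s2]) (use Suc.prems in simp)
    then obtain v s3 where v: "exec ?w ?s2 v s3" "v \<le> k * (T + 20) + 12"
        "J N s3" "agree_off (insert x (mods c)) s s3"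
      by (auto simp: run_def)
    from exec.WhileTrue[OF b c' v(1)] have "exec ?w s' (bcost ?b + (u + 6) + v) s3" .
    moreover have "bcost ?b + (u + 6) + v \<le> Suc k * (T + 20) + 12" using u v T' by simp
    ultimately show ?case using v unfolding run_def by blast
  qed
  let ?s0 = "s(x := (s x)(0 := 0))"
  have "run ?w ?s0 (N * (T + 20) + 12) (\<lambda>s'. J N s' \<and> agree_off (insert x (mods c)) s s')"
    using init counter by (intro loop[of _ 0]) (auto simp: agree_off_def)
  then have w: "run ?w ?s0 (N * (T + 20) + 12) Q"
    by (rule run_weaken) (use final in auto)
  have i: "run (Set_Var x (Const 0)) s 3 (\<lambda>s'. s' = ?s0)"
    by (rule run_loop_free) auto
  have "N * (T + 20) \<le> z * (T + 20)" using T'(1) by (rule mult_le_mono1)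
  then have "3 + (N * (T + 20) + 12) \<le> T'" using T'(3) unfolding for_cost_def by linarith
  with w show ?thesis unfolding For_def by (intro run_Seq[OF i]) auto
qed

section \<open>Augmenting paths\<close>

abbreviation At :: "string \<Rightarrow> string \<Rightarrow> aexp" where
  "At x i \<equiv> Cell x (Var i)"

text \<open>\<open>R w\<close> is one plus the depth of \<open>w\<close> in a search tree from \<open>r\<close>, and 0 if \<open>w\<close> was not found;
  \<open>P w\<close> is the arc by which \<open>w\<close> was found. Only depths up to \<open>d\<close> are considered, because reversing
  a path destroys the tree from its end upwards.\<close>

definition search_tree :: "(nat \<Rightarrow> nat) \<Rightarrow> (nat \<Rightarrow> nat) \<Rightarrow> nat \<Rightarrow> nat \<Rightarrow> nat \<Rightarrow> (nat \<Rightarrow> nat) \<Rightarrow> (nat \<Rightarrow> nat)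
    \<Rightarrow> nat \<Rightarrow> bool" where
  "search_tree t h n m r R P d \<longleftrightarrow> R r = 1 \<and> (\<forall>w<n. 0 < R w \<longrightarrow> R w \<le> d \<longrightarrow> w \<noteq> r \<longrightarrow>
     P w < m \<and> h (P w) = w \<and> 0 < R (t (P w)) \<and> R (t (P w)) < R w)"

section \<open>Breadth-first search and reversal of the path found\<close>

definition search_closed :: "(nat \<Rightarrow> nat) \<Rightarrow> (nat \<Rightarrow> nat) \<Rightarrow> nat \<Rightarrow> (nat \<Rightarrow> nat) \<Rightarrow> bool" where
  "search_closed t h m R \<longleftrightarrow> (\<forall>e<m. 0 < R (t e) \<longrightarrow> 0 < R (h e))"

text \<open>A counting argument for termination: a round that starts with a set not yet closed finds
  a new vertex, so after \<open>n\<close> rounds the second alternative would give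
  \<open>n + 1\<close> vertices below \<open>n\<close>.\<close>

definition search_inv :: "(nat \<Rightarrow> nat) \<Rightarrow> (nat \<Rightarrow> nat) \<Rightarrow> nat \<Rightarrow> nat \<Rightarrow> nat \<Rightarrow> nat
    \<Rightarrow> (nat \<Rightarrow> nat) \<Rightarrow> (nat \<Rightarrow> nat) \<Rightarrow> bool" where
  "search_inv t h n m r j R P \<longleftrightarrow> search_tree t h n m r R P (j + 1) \<and> (\<forall>w<n. R w \<le> j + 1) \<and>
     (search_closed t h m R \<or> j + 1 \<le> card {w. w < n \<and> 0 < R w})"

text \<open>The state inside round \<open>j\<close> after \<open>a\<close> arcs. The last
  alternative describes a round that has found nothing so far: then no vertex has the new depth, and
  the arcs already scanned do not leave the found set.\<close>

definition visit_inv :: "(nat \<Rightarrow> nat) \<Rightarrow> (nat \<Rightarrow> nat) \<Rightarrow> nat \<Rightarrow> nat \<Rightarrow> nat \<Rightarrow> nat \<Rightarrow> nat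
    \<Rightarrow> (nat \<Rightarrow> nat) \<Rightarrow> (nat \<Rightarrow> nat) \<Rightarrow> bool" where
  "visit_inv t h n m r j a R P \<longleftrightarrow> search_tree t h n m r R P (j + 2) \<and> (\<forall>w<n. R w \<le> j + 2) \<and>
     (search_closed t h m R \<or> j + 2 \<le> card {w. w < n \<and> 0 < R w} \<or>
      j + 1 \<le> card {w. w < n \<and> 0 < R w} \<and> (\<forall>w<n. R w \<le> j + 1) \<and> search_closed t h a R)"

lemma visit_inv_0:
  assumes "search_inv t h n m r j R P"
  shows "visit_inv t h n m r j 0 R P"
  using assms unfolding search_inv_def visit_inv_def search_tree_def search_closed_def
  by (auto simp: le_Suc_eq)

lemma search_inv_Suc:
  assumes "visit_inv t h n m r j m R P"
  shows "search_inv t h n m r (Suc j) R P"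
  using assms unfolding search_inv_def visit_inv_def by auto

text \<open>An arc from a found to an unfound vertex refutes closedness, so the invariant supplies
  the count \<open>j + 1\<close>, which now grows. Since \<open>R (h a) = 0\<close>, the vertex
  \<open>h a\<close> is neither \<open>r\<close> nor the tail of a tree arc, and the rest of the
  tree stays intact.\<close>

lemma visit_inv_Suc_visit:
  assumes inv: "visit_inv t h n m r j a R P" and a: "a < m" "h a < n"
    and c: "0 < R (t a)" "R (t a) < j + 2" "R (h a) = 0"
  shows "visit_inv t h n m r j (Suc a) (R(h a := j + 2)) (P(h a := a))"
proof -
  let ?R = "R(h a := j + 2)"
  have "{w. w < n \<and> 0 < ?R w} = insert (h a) {w. w < n \<and> 0 < R w}" using a by auto
  then have "card {w. w < n \<and> 0 < ?R w} = Suc (card {w. w < n \<and> 0 < R w})" using c by simp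
  moreover have "\<not> search_closed t h m R" using a c by (auto simp: search_closed_def)
  then have "j + 1 \<le> card {w. w < n \<and> 0 < R w}" using inv by (auto simp: visit_inv_def)
  moreover have "search_tree t h n m r ?R (P(h a := a)) (j + 2)"
    using inv a c unfolding visit_inv_def search_tree_def by auto
  moreover have "\<forall>w<n. ?R w \<le> j + 2" using inv by (auto simp: visit_inv_def)
  ultimately show ?thesis unfolding visit_inv_def by auto
qed

lemma visit_inv_Suc_skip:
  assumes inv: "visit_inv t h n m r j a R P" and a: "t a < n"
    and c: "\<not> (0 < R (t a) \<and> R (t a) < j + 2 \<and> R (h a) = 0)"
  shows "visit_inv t h n m r j (Suc a) R P"
  using assms unfolding visit_inv_def search_closed_def by (fastforce simp: less_Suc_eq)

lemma search_inv_closed: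
  assumes "search_inv t h n m r n R P"
  shows "search_closed t h m R"
proof -
  have "card {w. w < n \<and> 0 < R w} \<le> card {..<n}" by (rule card_mono) auto
  then show ?thesis using assms by (auto simp: search_inv_def)
qed

definition visit :: com where
  "visit =
    Cond (Conj (Less (Const 0) (Cell ''reach'' (At ''ft'' ''a'')))
         (Conj (Less (Cell ''reach'' (At ''ft'' ''a'')) (Plus (Var ''j'') (Const 2)))
               (Equal (Cell ''reach'' (At ''fh'' ''a'')) (Const 0))))
      (Seq (Assign ''pred'' (At ''fh'' ''a'') (Var ''a''))
           (Assign ''reach'' (At ''fh'' ''a'') (Plus (Var ''j'') (Const 2))))
      Skip"

lemma mods_visit [simp]: "mods visit = {''pred'', ''reach''}"
  by (auto simp: visit_def)

definition search :: com where
  "search =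
    Seq (For ''w'' (Var ''vertices'') (Assign ''reach'' (Var ''w'') (Const 0)))
   (Seq (Assign ''reach'' (Var ''root'') (Const 1))
    (For ''j'' (Var ''vertices'') (For ''a'' (Var ''arcs'') visit)))"

lemma mods_search: "mods search = {''w'', ''reach'', ''j'', ''a'', ''pred''}"
  by (auto simp: search_def)

text \<open>The constants here and in the later cost functions are generous allowances for loop-free
  pieces, verified by evaluating \<open>cost_bound\<close>.\<close>

definition search_cost :: "nat \<Rightarrow> nat" where
  "search_cost z = for_cost z 10 + 10 + for_cost z (for_cost z 100)"

lemma run_search:
  assumes s: "s ''vertices'' 0 = n" "s ''arcs'' 0 = m" "s ''root'' 0 = r" "s ''ft'' = t" "s ''fh'' = h"
    and r: "r < n" and ends: "\<forall>e<m. t e < n \<and> h e < n" and z: "n \<le> z" "m \<le> z"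
  shows "run search s (search_cost z) (\<lambda>s'. search_inv t h n m r n (s' ''reach'') (s' ''pred''))"
  unfolding search_def
proof (rule run_Seq)
  show "run (For ''w'' (Var ''vertices'') (Assign ''reach'' (Var ''w'') (Const 0))) s (for_cost z 10)
      (\<lambda>s'. \<forall>w<n. s' ''reach'' w = 0)"
  proof (rule run_For[where J = "\<lambda>j s'. \<forall>w<j. s' ''reach'' w = 0" and N = n and z = z and T = 10])
    fix j and s' :: store assume "s' ''w'' 0 = j" "\<forall>w<j. s' ''reach'' w = 0"
    then show "run (Assign ''reach'' (Var ''w'') (Const 0)) s' 10 (\<lambda>s'. \<forall>w<Suc j. s' ''reach'' w = 0)"
      by (intro run_loop_free) (auto simp: less_Suc_eq)
  qed (use s z in \<open>auto simp: agree_off_def\<close>)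
next
  fix s1 :: store assume s1: "agree_off (mods (For ''w'' (Var ''vertices'') (Assign ''reach'' (Var ''w'') (Const 0)))) s s1"
    "\<forall>w<n. s1 ''reach'' w = 0"
  show "run (Seq (Assign ''reach'' (Var ''root'') (Const 1))
    (For ''j'' (Var ''vertices'') (For ''a'' (Var ''arcs'') visit))) s1 (10 + for_cost z (for_cost z 100))
     (\<lambda>s'. search_inv t h n m r n (s' ''reach'') (s' ''pred''))"
  proof (rule run_Seq)
    have "{w. w < n \<and> 0 < ((s1 ''reach'')(r := Suc 0)) w} = {r}"
      using s1(2) r by auto
    then have "search_inv t h n m r 0 ((s1 ''reach'')(r := Suc 0)) (s1 ''pred'')"
      using s1(2) r by (auto simp: search_inv_def search_tree_def)
    then show "run (Assign ''reach'' (Var ''root'') (Const 1)) s1 10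
       (\<lambda>s'. search_inv t h n m r 0 (s' ''reach'') (s' ''pred''))"
      using s s1(1) by (intro run_loop_free) (auto simp: agree_off_def)
  next
    fix s2 :: store assume "agree_off (mods (Assign ''reach'' (Var ''root'') (Const 1))) s1 s2"
      and init: "search_inv t h n m r 0 (s2 ''reach'') (s2 ''pred'')"
    with s s1(1) have s2: "s2 ''vertices'' 0 = n" "s2 ''arcs'' 0 = m" "s2 ''ft'' = t" "s2 ''fh'' = h"
      by (auto simp: agree_off_def)
    show "run (For ''j'' (Var ''vertices'') (For ''a'' (Var ''arcs'') visit)) s2 (for_cost z (for_cost z 100))
      (\<lambda>s'. search_inv t h n m r n (s' ''reach'') (s' ''pred''))"
    proof (rule run_For[where J = "\<lambda>j s'. search_inv t h n m r j (s' ''reach'') (s' ''pred'')" and N = n and z = z])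
      fix j and s3 :: store
      assume j: "s3 ''j'' 0 = j" "search_inv t h n m r j (s3 ''reach'') (s3 ''pred'')"
        "agree_off (insert ''j'' (mods (For ''a'' (Var ''arcs'') visit))) s2 s3"
      show "run (For ''a'' (Var ''arcs'') visit) s3 (for_cost z 100)
          (\<lambda>s'. search_inv t h n m r (Suc j) (s' ''reach'') (s' ''pred''))"
      proof (rule run_For[where J = "\<lambda>a s'. visit_inv t h n m r j a (s' ''reach'') (s' ''pred'')"
              and N = m and z = z])
        fix a and s4 :: store
        assume a: "a < m" "s4 ''a'' 0 = a" "visit_inv t h n m r j a (s4 ''reach'') (s4 ''pred'')"
          "agree_off (insert ''a'' (mods visit)) s3 s4"
        then have s4: "s4 ''j'' 0 = j" "s4 ''ft'' = t" "s4 ''fh'' = h"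
          using j s2 by (auto simp: agree_off_def)
        show "run visit s4 100 (\<lambda>s'. visit_inv t h n m r j (Suc a) (s' ''reach'') (s' ''pred''))"
          using visit_inv_Suc_visit[OF a(3,1)] visit_inv_Suc_skip[OF a(3)] ends a(1,2) s4
          by (intro run_loop_free) (auto simp: visit_def)
      qed (use j s2 z visit_inv_0 search_inv_Suc in \<open>auto simp: agree_off_def\<close>)
    qed (use s2 z init in \<open>auto simp: agree_off_def\<close>)
  qed simp
qed (simp add: search_cost_def)

text \<open>When the part of the path after \<open>c\<close> is reversed, a set \<open>U\<close> around \<open>y\<close> has lost one entering
  arc iff \<open>c\<close> lies outside \<open>U\<close>.\<close>

definition reverse_inv :: "nat \<Rightarrow> nat \<Rightarrow> nat \<Rightarrow> nat \<Rightarrow> (nat \<Rightarrow> nat) \<Rightarrow> (nat \<Rightarrow> nat)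
    \<Rightarrow> (nat set \<Rightarrow> nat) \<Rightarrow> nat \<Rightarrow> (nat \<Rightarrow> nat) \<Rightarrow> (nat \<Rightarrow> nat) \<Rightarrow> nat \<Rightarrow> bool" where
  "reverse_inv n m r y R P g b t h c \<longleftrightarrow> c < n \<and> 0 < R c \<and> R c + b \<le> n + 1 \<and>
     (\<forall>e<m. t e < n \<and> h e < n) \<and> search_tree t h n m r R P (R c) \<and>
     (\<forall>U. y \<in> U \<longrightarrow> r \<notin> U \<longrightarrow> indeg t h {..<m} U + of_bool (c \<notin> U) = g U)"

text \<open>By \<open>indeg_reverse_arc\<close> with \<open>h p = c\<close>, the correction term
  moves from \<open>c\<close> to \<open>t p\<close>. The bound on \<open>R c + b\<close> survives
  because a parent is strictly less deep.\<close>

lemma reverse_inv_Suc: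
  assumes inv: "reverse_inv n m r y R P g b t h c" and c: "c \<noteq> r"
  defines "p \<equiv> P c"
  shows "reverse_inv n m r y R P g (Suc b) (t(p := h p)) (h(p := t p)) (t p)"
proof -
  have p: "p < m" "h p = c" "0 < R (t p)" "R (t p) < R c" and R: "R r = 1"
    using inv c unfolding reverse_inv_def search_tree_def p_def by auto
  have "indeg (t(p := h p)) (h(p := t p)) {..<m} U + of_bool (t p \<notin> U)
      = indeg t h {..<m} U + of_bool (c \<notin> U)" for U
    using indeg_reverse_arc[of "{..<m}" p t h U] p by simp
  moreover have "search_tree (t(p := h p)) (h(p := t p)) n m r R P (R (t p))"
    unfolding search_tree_def
  proof (intro conjI R allI impI)
    fix w assume w: "w < n" "0 < R w" "R w \<le> R (t p)" "w \<noteq> r"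
    then have "P w < m \<and> h (P w) = w \<and> 0 < R (t (P w)) \<and> R (t (P w)) < R w"
      using inv p unfolding reverse_inv_def search_tree_def by auto
    \<comment> \<open>The arc \<open>p\<close> ends in \<open>c\<close>, which is deeper than
      \<open>t p\<close> and therefore different from \<open>w\<close>.\<close>
    moreover from this have "P w \<noteq> p" using p w by auto
    ultimately show "P w < m" "(h(p := t p)) (P w) = w" "0 < R ((t(p := h p)) (P w))"
        "R ((t(p := h p)) (P w)) < R w"
      by auto
  qed
  ultimately show ?thesis using inv p unfolding reverse_inv_def by auto
qed

text \<open>A counted loop that idles once the root is reached, so that its time follows from the
  rule for \<open>For\<close>. Advancing \<open>cur\<close> before the swap lets it hold the old
  tail.\<close>

definition reverse_path :: com where
  "reverse_path =
    Seq (Set_Var ''cur'' (Var ''y''))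
    (For ''b'' (Var ''vertices'')
      (Cond (Neg (Equal (Var ''cur'') (Var ''root'')))
        (Seq (Set_Var ''p'' (At ''pred'' ''cur''))
        (Seq (Set_Var ''cur'' (At ''ft'' ''p''))
        (Seq (Assign ''ft'' (Var ''p'') (At ''fh'' ''p''))
             (Assign ''fh'' (Var ''p'') (Var ''cur'')))))
        Skip))"

lemma mods_reverse_path: "mods reverse_path = {''cur'', ''b'', ''p'', ''ft'', ''fh''}"
  by (auto simp: reverse_path_def)

lemma run_reverse_path:
  assumes s: "s ''vertices'' 0 = n" "s ''root'' 0 = r" "s ''y'' 0 = y" "s ''ft'' = t" "s ''fh'' = h"
      "s ''reach'' = R" "s ''pred'' = P"
    and y: "y < n" "0 < R y" and ends: "\<forall>e<m. t e < n \<and> h e < n"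
    and inv: "search_inv t h n m r n R P" and z: "n \<le> z"
  shows "run reverse_path s (10 + for_cost z 100) (\<lambda>s'.
    (\<forall>e<m. s' ''ft'' e < n \<and> s' ''fh'' e < n) \<and>
    (\<forall>U. y \<in> U \<longrightarrow> r \<notin> U \<longrightarrow>
      indeg (s' ''ft'') (s' ''fh'') {..<m} U + 1 = indeg t h {..<m} U))"
  unfolding reverse_path_def
proof (rule run_Seq)
  show "run (Set_Var ''cur'' (Var ''y'')) s 10 (\<lambda>s'. s' ''cur'' 0 = y)"
    using s by (intro run_loop_free) auto
next
  let ?c = "Cond (Neg (Equal (Var ''cur'') (Var ''root'')))
        (Seq (Set_Var ''p'' (At ''pred'' ''cur''))
        (Seq (Set_Var ''cur'' (At ''ft'' ''p''))
        (Seq (Assign ''ft'' (Var ''p'') (At ''fh'' ''p''))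
             (Assign ''fh'' (Var ''p'') (Var ''cur'')))))
        Skip"
  let ?g = "indeg t h {..<m}"
  fix s1 :: store assume "agree_off (mods (Set_Var ''cur'' (Var ''y''))) s s1" and cur: "s1 ''cur'' 0 = y"
  then have s1: "s1 ''vertices'' 0 = n" "s1 ''root'' 0 = r" "s1 ''ft'' = t" "s1 ''fh'' = h"
      "s1 ''reach'' = R" "s1 ''pred'' = P"
    using s by (auto simp: agree_off_def)
  have init: "reverse_inv n m r y R P ?g 0 t h y"
    using inv y ends unfolding reverse_inv_def search_inv_def search_tree_def
    by (auto dest: spec[of _ y])
  show "run (For ''b'' (Var ''vertices'') ?c) s1 (for_cost z 100) (\<lambda>s'.
    (\<forall>e<m. s' ''ft'' e < n \<and> s' ''fh'' e < n) \<and>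
    (\<forall>U. y \<in> U \<longrightarrow> r \<notin> U \<longrightarrow>
      indeg (s' ''ft'') (s' ''fh'') {..<m} U + 1 = indeg t h {..<m} U))"
  proof (rule run_For[where J = "\<lambda>b s'. reverse_inv n m r y R P ?g b (s' ''ft'') (s' ''fh'') (s' ''cur'' 0)"
        and N = n and z = z])
    fix b and s2 :: store
    assume b: "b < n" and J: "reverse_inv n m r y R P ?g b (s2 ''ft'') (s2 ''fh'') (s2 ''cur'' 0)"
      and "agree_off (insert ''b'' (mods ?c)) s1 s2"
    then have s2: "s2 ''root'' 0 = r" "s2 ''pred'' = P" using s1 by (auto simp: agree_off_def)
    \<comment> \<open>An idle round: \<open>R r = 1\<close>, so the depth bound still holds for
      \<open>Suc b\<close> because \<open>b < n\<close>.\<close>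
    have "reverse_inv n m r y R P ?g (Suc b) (s2 ''ft'') (s2 ''fh'') r" if "s2 ''cur'' 0 = r"
      using J b that by (auto simp: reverse_inv_def search_tree_def)
    with reverse_inv_Suc[OF J] s2
    show "run ?c s2 100 (\<lambda>s'. reverse_inv n m r y R P ?g (Suc b) (s' ''ft'') (s' ''fh'') (s' ''cur'' 0))"
      by (intro run_loop_free) auto
  next
    fix s2 :: store assume J: "reverse_inv n m r y R P ?g n (s2 ''ft'') (s2 ''fh'') (s2 ''cur'' 0)"
    have "s2 ''cur'' 0 = r"
    proof (rule ccontr)
      assume "s2 ''cur'' 0 \<noteq> r"
      \<comment> \<open>A further reversal would give a positive depth \<open>d\<close> with
        \<open>d + Suc n \<le> n + 1\<close>.\<close>
      from reverse_inv_Suc[OF J this] show False by (auto simp: reverse_inv_def)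
    qed
    with J show "(\<forall>e<m. s2 ''ft'' e < n \<and> s2 ''fh'' e < n) \<and>
      (\<forall>U. y \<in> U \<longrightarrow> r \<notin> U \<longrightarrow> indeg (s2 ''ft'') (s2 ''fh'') {..<m} U + 1 = ?g U)"
      by (auto simp: reverse_inv_def)
  qed (use s1 z init cur in \<open>auto simp: agree_off_def\<close>)
qed simp

section \<open>The maximum flow test for a single arc\<close>

definition augment_inv :: "nat \<Rightarrow> nat \<Rightarrow> nat \<Rightarrow> nat \<Rightarrow> (nat set \<Rightarrow> nat) \<Rightarrow> nat \<Rightarrow> nat
    \<Rightarrow> (nat \<Rightarrow> nat) \<Rightarrow> (nat \<Rightarrow> nat) \<Rightarrow> nat \<Rightarrow> bool" where
  "augment_inv n m r y g L q t h ok \<longleftrightarrow>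
    (if ok = 1 then (\<forall>e<m. t e < n \<and> h e < n) \<and>
         (\<forall>U. y \<in> U \<longrightarrow> r \<notin> U \<longrightarrow> indeg t h {..<m} U + q = g U)
     else \<exists>U \<subseteq> {..<n}. y \<in> U \<and> r \<notin> U \<and> g U < L)"

definition augment :: com where
  "augment =
    Cond (Equal (Var ''ok'') (Const 1))
      (Seq search
        (Cond (Less (Const 0) (At ''reach'' ''y'')) reverse_path (Set_Var ''ok'' (Const 0))))
      Skip"

lemma mods_augment:
  "mods augment = {''w'', ''reach'', ''j'', ''a'', ''pred'', ''cur'', ''b'', ''p'', ''ft'', ''fh'', ''ok''}"
  by (auto simp: augment_def mods_search mods_reverse_path)

definition augment_cost :: "nat \<Rightarrow> nat" where
  "augment_cost z = search_cost z + for_cost z 100 + 100"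

text \<open>The working arrays act as the residual digraph of a flow of value \<open>q\<close>, and
  \<open>g\<close> gives the in-degrees before the first augmentation. Reversing a path lowers all
  relevant cuts by one more. If \<open>y\<close> is not found, the unfound vertices form a set
  entered by no residual arc, so its original in-degree is \<open>q\<close>, which is below
  \<open>L\<close>: a certificate of failure.\<close>

lemma run_augment:
  assumes s: "s ''vertices'' 0 = n" "s ''arcs'' 0 = m" "s ''root'' 0 = r" "s ''y'' 0 = y"
    and bounds: "r < n" "y < n" "q < L" and z: "n \<le> z" "m \<le> z"
    and inv: "augment_inv n m r y g L q (s ''ft'') (s ''fh'') (s ''ok'' 0)"
  shows "run augment s (augment_cost z)
    (\<lambda>s'. augment_inv n m r y g L (Suc q) (s' ''ft'') (s' ''fh'') (s' ''ok'' 0))"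
  unfolding augment_def
proof (rule run_Cond)
  assume "\<not> bval (Equal (Var ''ok'') (Const 1)) s"
  with inv show "run Skip s (search_cost z + for_cost z 100 + 90)
      (\<lambda>s'. augment_inv n m r y g L (Suc q) (s' ''ft'') (s' ''fh'') (s' ''ok'' 0))"
    by (intro run_loop_free) (auto simp: augment_inv_def)
next
  assume "bval (Equal (Var ''ok'') (Const 1)) s"
  then have ok: "s ''ok'' 0 = 1" by simp
  let ?t = "s ''ft''" and ?h = "s ''fh''"
  from inv ok have ends: "\<forall>e<m. ?t e < n \<and> ?h e < n"
    and g: "\<And>U. y \<in> U \<Longrightarrow> r \<notin> U \<Longrightarrow> indeg ?t ?h {..<m} U + q = g U"
    by (auto simp: augment_inv_def)
  show "run (Seq search
        (Cond (Less (Const 0) (At ''reach'' ''y'')) reverse_path (Set_Var ''ok'' (Const 0))))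
      s (search_cost z + for_cost z 100 + 90)
      (\<lambda>s'. augment_inv n m r y g L (Suc q) (s' ''ft'') (s' ''fh'') (s' ''ok'' 0))"
  proof (rule run_Seq[OF run_search[OF s(1-3) refl refl bounds(1) ends z]])
    fix s1 assume a: "agree_off (mods search) s s1"
      and inv1: "search_inv ?t ?h n m r n (s1 ''reach'') (s1 ''pred'')"
    have s1: "s1 ''vertices'' 0 = n" "s1 ''root'' 0 = r" "s1 ''y'' 0 = y" "s1 ''ft'' = ?t"
        "s1 ''fh'' = ?h" "s1 ''ok'' 0 = 1"
      using a s ok by (auto simp: agree_off_def mods_search)
    show "run (Cond (Less (Const 0) (At ''reach'' ''y'')) reverse_path (Set_Var ''ok'' (Const 0)))
      s1 (for_cost z 100 + 50)
      (\<lambda>s'. augment_inv n m r y g L (Suc q) (s' ''ft'') (s' ''fh'') (s' ''ok'' 0))"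
    proof (rule run_Cond)
      assume "bval (Less (Const 0) (At ''reach'' ''y'')) s1"
      then have "0 < s1 ''reach'' y" using s1 by simp
      from run_reverse_path[OF s1(1-5) refl refl bounds(2) this ends inv1 z(1)]
      show "run reverse_path s1 (for_cost z 100 + 20)
        (\<lambda>s'. augment_inv n m r y g L (Suc q) (s' ''ft'') (s' ''fh'') (s' ''ok'' 0))"
      proof (rule run_weaken)
        fix s2 :: store
        assume "agree_off (mods reverse_path) s1 s2" and
          J: "(\<forall>e<m. s2 ''ft'' e < n \<and> s2 ''fh'' e < n) \<and>
            (\<forall>U. y \<in> U \<longrightarrow> r \<notin> U \<longrightarrow>
              indeg (s2 ''ft'') (s2 ''fh'') {..<m} U + 1 = indeg ?t ?h {..<m} U)"
        then have "s2 ''ok'' 0 = 1" using s1 by (auto simp: agree_off_def mods_reverse_path)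
        moreover have "indeg (s2 ''ft'') (s2 ''fh'') {..<m} U + Suc q = g U"
          if "y \<in> U" "r \<notin> U" for U
          using J g[OF that] that by force
        ultimately show "augment_inv n m r y g L (Suc q) (s2 ''ft'') (s2 ''fh'') (s2 ''ok'' 0)"
          using J by (auto simp: augment_inv_def)
      qed simp
    next
      assume "\<not> bval (Less (Const 0) (At ''reach'' ''y'')) s1"
      then have y: "s1 ''reach'' y = 0" using s1 by simp
      let ?U = "{w. w < n \<and> s1 ''reach'' w = 0}"
      have r: "s1 ''reach'' r = 1" using inv1 by (simp add: search_inv_def search_tree_def)
      have "{e \<in> {..<m}. ?t e \<notin> ?U \<and> ?h e \<in> ?U} = {}"
        using search_inv_closed[OF inv1] ends by (auto simp: search_closed_def)
      then have "indeg ?t ?h {..<m} ?U = 0" unfolding indeg_def by (simp only: card.empty)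
      then have "g ?U < L" using g[of ?U] y r bounds by simp
      then have "\<exists>U \<subseteq> {..<n}. y \<in> U \<and> r \<notin> U \<and> g U < L"
        using y r bounds by (intro exI[of _ ?U]) auto
      then show "run (Set_Var ''ok'' (Const 0)) s1 (for_cost z 100 + 20)
        (\<lambda>s'. augment_inv n m r y g L (Suc q) (s' ''ft'') (s' ''fh'') (s' ''ok'' 0))"
        by (intro run_loop_free) (auto simp: augment_inv_def)
    qed simp
  qed simp
qed (simp add: augment_cost_def)

text \<open>Arcs that may not be used are copied as loops, which enter no set.\<close>

definition copy_arc :: com where
  "copy_arc =
    Cond (Conj (Equal (At ''used'' ''a'') (Const 0)) (Neg (Equal (Var ''a'') (Var ''e''))))
      (Seq (Assign ''ft'' (Var ''a'') (At ''tail'' ''a'')) (Assign ''fh'' (Var ''a'') (At ''head'' ''a'')))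
      (Seq (Assign ''ft'' (Var ''a'') (Const 0)) (Assign ''fh'' (Var ''a'') (Const 0)))"

lemma mods_copy_arc [simp]: "mods copy_arc = {''ft'', ''fh''}"
  by (auto simp: copy_arc_def)

definition test_arc :: com where
  "test_arc =
    Seq (For ''a'' (Var ''arcs'') copy_arc)
   (Seq (Set_Var ''ok'' (Const 1))
    (For ''q'' (Minus (Var ''level'') (Var ''i'')) augment))"

lemma mods_test_arc: "mods test_arc = {''w'', ''reach'', ''j'', ''a'', ''pred'', ''cur'', ''b'', ''p'',
    ''ft'', ''fh'', ''ok'', ''q''}"
  by (auto simp: test_arc_def mods_augment)

definition test_cost :: "nat \<Rightarrow> nat" where
  "test_cost z = for_cost z 100 + 10 + for_cost z (augment_cost z)"

definition unused :: "nat \<Rightarrow> (nat \<Rightarrow> nat) \<Rightarrow> nat set" where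
  "unused m u = {a. a < m \<and> u a = 0}"

lemma run_test_arc:
  assumes s: "s ''vertices'' 0 = n" "s ''arcs'' 0 = m" "s ''root'' 0 = r" "s ''y'' 0 = y"
      "s ''e'' 0 = e" "s ''used'' = u" "s ''level'' 0 = l" "s ''i'' 0 = i"
    and bounds: "r < n" "y < n" and z: "n \<le> z" "m \<le> z" "l \<le> z"
    and t: "\<And>a. a < m \<Longrightarrow> s ''tail'' a = t a \<and> s ''head'' a = h a"
    and ends: "\<forall>a<m. t a < n \<and> h a < n"
  shows "run test_arc s (test_cost z) (\<lambda>s'. s' ''ok'' 0 = 1 \<longleftrightarrow>
    (\<forall>U \<subseteq> {..<n}. y \<in> U \<longrightarrow> r \<notin> U \<longrightarrow> l - i \<le> indeg t h (unused m u - {e}) U))"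
  unfolding test_arc_def
proof (rule run_Seq)
  let ?kept = "\<lambda>a. u a = 0 \<and> a \<noteq> e"
  let ?J = "\<lambda>a s'. \<forall>b<a. s' ''ft'' b = (if ?kept b then t b else 0) \<and> s' ''fh'' b = (if ?kept b then h b else 0)"
  let ?g = "indeg t h (unused m u - {e})"
  let ?aug = "\<lambda>q s'. augment_inv n m r y ?g (l - i) q (s' ''ft'') (s' ''fh'') (s' ''ok'' 0)"
  show "run (For ''a'' (Var ''arcs'') copy_arc) s (for_cost z 100) (?J m)"
  proof (rule run_For[where J = ?J and N = m and z = z])
    fix a and s' :: store
    assume a: "a < m" "s' ''a'' 0 = a" "?J a s'" "agree_off (insert ''a'' (mods copy_arc)) s s'"
    then have s': "s' ''e'' 0 = e" "s' ''used'' = u" "s' ''tail'' a = t a" "s' ''head'' a = h a"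
      using s t by (auto simp: agree_off_def)
    show "run copy_arc s' 100 (?J (Suc a))"
      using a(2,3) s' by (intro run_loop_free) (auto simp: copy_arc_def less_Suc_eq)
  qed (use s z in \<open>auto simp: agree_off_def\<close>)
  fix s1 assume a1: "agree_off (mods (For ''a'' (Var ''arcs'') copy_arc)) s s1" and J: "?J m s1"
  have g: "indeg (s1 ''ft'') (s1 ''fh'') {..<m} U = ?g U" for U
    unfolding indeg_def using J by (intro arg_cong[where f = card]) (auto simp: unused_def split: if_splits)
  \<comment> \<open>The loops that replace excluded arcs sit at vertex 0, which exists because
    \<open>r < n\<close>.\<close>
  have "\<forall>a<m. s1 ''ft'' a < n \<and> s1 ''fh'' a < n" using J ends bounds by auto
  with g have inv: "augment_inv n m r y ?g (l - i) 0 (s1 ''ft'') (s1 ''fh'') 1"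
    by (simp add: augment_inv_def)
  show "run (Seq (Set_Var ''ok'' (Const 1)) (For ''q'' (Minus (Var ''level'') (Var ''i'')) augment)) s1
    (10 + for_cost z (augment_cost z)) (\<lambda>s'. s' ''ok'' 0 = 1 \<longleftrightarrow>
    (\<forall>U \<subseteq> {..<n}. y \<in> U \<longrightarrow> r \<notin> U \<longrightarrow> l - i \<le> ?g U))"
  proof (rule run_Seq)
    show "run (Set_Var ''ok'' (Const 1)) s1 10 (?aug 0)"
      using inv by (intro run_loop_free) auto
    fix s2 assume a2: "agree_off (mods (Set_Var ''ok'' (Const 1))) s1 s2" and init: "?aug 0 s2"
    have s2: "s2 ''vertices'' 0 = n" "s2 ''arcs'' 0 = m" "s2 ''root'' 0 = r" "s2 ''y'' 0 = y"
        "s2 ''level'' 0 = l" "s2 ''i'' 0 = i"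
      using s a1 a2 by (auto simp: agree_off_def)
    show "run (For ''q'' (Minus (Var ''level'') (Var ''i'')) augment) s2 (for_cost z (augment_cost z))
      (\<lambda>s'. s' ''ok'' 0 = 1 \<longleftrightarrow> (\<forall>U \<subseteq> {..<n}. y \<in> U \<longrightarrow> r \<notin> U \<longrightarrow> l - i \<le> ?g U))"
    proof (rule run_For[where J = ?aug and N = "l - i" and z = z])
      fix q and s3 :: store
      assume q: "q < l - i" "?aug q s3" and a3: "agree_off (insert ''q'' (mods augment)) s2 s3"
      show "run augment s3 (augment_cost z) (?aug (Suc q))"
        by (rule run_augment[OF _ _ _ _ bounds q(1) z(1,2) q(2)])
          (use s2 a3 in \<open>auto simp: agree_off_def mods_augment\<close>)
    next
      fix s3 :: store
      assume aug: "?aug (l - i) s3"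
      show "s3 ''ok'' 0 = 1 \<longleftrightarrow> (\<forall>U \<subseteq> {..<n}. y \<in> U \<longrightarrow> r \<notin> U \<longrightarrow> l - i \<le> ?g U)"
      \<comment> \<open>If all \<open>l - i\<close> augmentations succeeded, each
        \<open>?g U\<close> is a residual in-degree plus \<open>l - i\<close>; otherwise the
        invariant holds a deficient set.\<close>
      proof (cases "s3 ''ok'' 0 = 1")
        case True
        then have "l - i \<le> ?g U" if "y \<in> U" "r \<notin> U" for U
          using aug that unfolding augment_inv_def by (metis le_add2)
        with True show ?thesis by blast
      next
        case False
        with aug show ?thesis unfolding augment_inv_def by (meson not_le)
      qed
    qed (use s2 z init in \<open>auto simp: agree_off_def mods_augment\<close>)
  qed simp
qed (simp add: test_cost_def)

section \<open>Growing arborescences\<close>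

text \<open>The condition \<open>u a \<noteq> 0\<close> matters because the array of colors starts
  with 0 everywhere, so arcs not yet colored look like arcs of color 0.\<close>

definition color_class :: "(nat \<Rightarrow> nat) \<Rightarrow> (nat \<Rightarrow> nat) \<Rightarrow> nat \<Rightarrow> (nat \<Rightarrow> nat) \<Rightarrow> (nat \<Rightarrow> nat) \<Rightarrow> nat
    \<Rightarrow> (nat \<times> nat) set" where
  "color_class t h m u c j = {(t a, h a) |a. a < m \<and> u a \<noteq> 0 \<and> c a = j}"

text \<open>Edmonds' cut condition for the \<open>l + 1 - i\<close> arborescences still to be built,
  in additive form; for \<open>i = l + 1\<close> it demands nothing. The bound on \<open>x\<close>
  keeps the stamp \<open>i + 1\<close> fresh.\<close>

definition packing_inv :: "nat \<Rightarrow> nat \<Rightarrow> nat \<Rightarrow> nat \<Rightarrow> (nat \<Rightarrow> nat) \<Rightarrow> (nat \<Rightarrow> nat) \<Rightarrow> nat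
    \<Rightarrow> (nat \<Rightarrow> nat) \<Rightarrow> (nat \<Rightarrow> nat) \<Rightarrow> (nat \<Rightarrow> nat) \<Rightarrow> bool" where
  "packing_inv n m r l t h i u c x \<longleftrightarrow>
    (\<forall>U. U \<noteq> {} \<longrightarrow> U \<subseteq> {..<n} \<longrightarrow> r \<notin> U \<longrightarrow> l + 1 \<le> indeg t h (unused m u) U + i) \<and>
    (\<forall>j<i. \<forall>v<n. (r, v) \<in> (color_class t h m u c j)\<^sup>*) \<and>
    (\<forall>v<n. x v \<le> i) \<and> (\<forall>a<m. c a \<le> l)"

text \<open>The array \<open>X\<close> is never reset: \<open>v\<close> belongs to the arborescence of color \<open>i\<close> iff its cell holds
  \<open>i + 1\<close>, while smaller values are left over from earlier colors.\<close>

definition stamped :: "nat \<Rightarrow> (nat \<Rightarrow> nat) \<Rightarrow> nat \<Rightarrow> nat set" where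
  "stamped n x i = {v. v < n \<and> x v = i + 1}"

text \<open>Lovasz's invariant: every set must keep \<open>l - i\<close> entering arcs for the later
  colors, and a set that the current arborescence has not met must have one more by which it can be
  reached.\<close>

definition growth_inv :: "nat \<Rightarrow> nat \<Rightarrow> nat \<Rightarrow> nat \<Rightarrow> (nat \<Rightarrow> nat) \<Rightarrow> (nat \<Rightarrow> nat) \<Rightarrow> nat
    \<Rightarrow> (nat \<Rightarrow> nat) \<Rightarrow> (nat \<Rightarrow> nat) \<Rightarrow> (nat \<Rightarrow> nat) \<Rightarrow> bool" where
  "growth_inv n m r l t h i u c x \<longleftrightarrow>
    (\<forall>U. U \<noteq> {} \<longrightarrow> U \<subseteq> {..<n} \<longrightarrow> r \<notin> U \<longrightarrow> l - i \<le> indeg t h (unused m u) U) \<and>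
    (\<forall>U. U \<noteq> {} \<longrightarrow> U \<subseteq> {..<n} \<longrightarrow> U \<inter> stamped n x i = {} \<longrightarrow>
       l - i < indeg t h (unused m u) U) \<and>
    (\<forall>j<i. \<forall>v<n. (r, v) \<in> (color_class t h m u c j)\<^sup>*) \<and>
    (\<forall>v\<in>stamped n x i. (r, v) \<in> (color_class t h m u c i)\<^sup>*) \<and> r \<in> stamped n x i \<and>
    (\<forall>v<n. x v \<le> i + 1) \<and> (\<forall>a<m. c a \<le> l)"

text \<open>Only sets around \<open>h e\<close> are examined, since no other set loses an entering
  arc with \<open>e\<close>.\<close>

definition acceptable :: "nat \<Rightarrow> nat \<Rightarrow> nat \<Rightarrow> nat \<Rightarrow> (nat \<Rightarrow> nat) \<Rightarrow> (nat \<Rightarrow> nat) \<Rightarrow> nat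
    \<Rightarrow> (nat \<Rightarrow> nat) \<Rightarrow> (nat \<Rightarrow> nat) \<Rightarrow> nat \<Rightarrow> bool" where
  "acceptable n m r l t h i u x e \<longleftrightarrow>
    e \<in> unused m u \<and> t e \<in> stamped n x i \<and> h e \<notin> stamped n x i \<and>
    (\<forall>U \<subseteq> {..<n}. h e \<in> U \<longrightarrow> r \<notin> U \<longrightarrow> l - i \<le> indeg t h (unused m u - {e}) U)"

text \<open>The counting scheme of \<open>search_inv\<close> again: each pass over the arcs enlarges
  an incomplete arborescence, so \<open>n\<close> passes complete it. \<open>try_inv\<close> plays
  the role of \<open>visit_inv\<close> within a pass.\<close>

definition pass_inv :: "nat \<Rightarrow> nat \<Rightarrow> nat \<Rightarrow> nat \<Rightarrow> (nat \<Rightarrow> nat) \<Rightarrow> (nat \<Rightarrow> nat) \<Rightarrow> nat \<Rightarrow> nat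
    \<Rightarrow> (nat \<Rightarrow> nat) \<Rightarrow> (nat \<Rightarrow> nat) \<Rightarrow> (nat \<Rightarrow> nat) \<Rightarrow> bool" where
  "pass_inv n m r l t h i p u c x \<longleftrightarrow> growth_inv n m r l t h i u c x \<and>
    (stamped n x i = {..<n} \<or> p + 1 \<le> card (stamped n x i))"

definition try_inv :: "nat \<Rightarrow> nat \<Rightarrow> nat \<Rightarrow> nat \<Rightarrow> (nat \<Rightarrow> nat) \<Rightarrow> (nat \<Rightarrow> nat) \<Rightarrow> nat \<Rightarrow> nat \<Rightarrow> nat
    \<Rightarrow> (nat \<Rightarrow> nat) \<Rightarrow> (nat \<Rightarrow> nat) \<Rightarrow> (nat \<Rightarrow> nat) \<Rightarrow> bool" where
  "try_inv n m r l t h i p e u c x \<longleftrightarrow> growth_inv n m r l t h i u c x \<and>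
    (stamped n x i = {..<n} \<or> p + 2 \<le> card (stamped n x i) \<or>
     p + 1 \<le> card (stamped n x i) \<and> (\<forall>a<e. \<not> acceptable n m r l t h i u x a))"

section \<open>Preservation of the growth invariants\<close>

lemma finite_unused [simp]: "finite (unused m u)"
  by (simp add: unused_def)

lemma finite_stamped [simp]: "finite (stamped n x i)"
  by (simp add: stamped_def)

lemma growth_inv_start:
  assumes inv: "packing_inv n m r l t h i u c x" and r: "r < n" and i: "i \<le> l"
  shows "growth_inv n m r l t h i u c (x(r := i + 1))"
proof -
  \<comment> \<open>All cells hold at most \<open>i\<close>, so no value left over from an earlier
    color equals the stamp \<open>i + 1\<close>.\<close>
  have x: "stamped n (x(r := i + 1)) i = {r}"
    using inv r by (force simp: packing_inv_def stamped_def)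
  have "l - i < indeg t h (unused m u) U" if "U \<noteq> {}" "U \<subseteq> {..<n}" "r \<notin> U" for U
  proof -
    have "l + 1 \<le> indeg t h (unused m u) U + i" using inv that unfolding packing_inv_def by blast
    then show ?thesis using i by linarith
  qed
  moreover from this have "l - i \<le> indeg t h (unused m u) U" if "U \<noteq> {}" "U \<subseteq> {..<n}" "r \<notin> U" for U
    using that less_imp_le by blast
  ultimately show ?thesis
    using inv unfolding growth_inv_def x packing_inv_def by (auto simp: le_Suc_eq)
qed

lemma packing_inv_Suc:
  assumes inv: "growth_inv n m r l t h i u c x" and x: "stamped n x i = {..<n}" and i: "i \<le> l"
  shows "packing_inv n m r l t h (Suc i) u c x"
proof -
  have "l + 1 \<le> indeg t h (unused m u) U + Suc i" if "U \<noteq> {}" "U \<subseteq> {..<n}" "r \<notin> U" for U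
  proof -
    have "l - i \<le> indeg t h (unused m u) U" using inv that unfolding growth_inv_def by blast
    then show ?thesis using i by linarith
  qed
  then show ?thesis using inv unfolding growth_inv_def x packing_inv_def by (auto simp: less_Suc_eq)
qed

text \<open>For sets around \<open>h e\<close> the acceptance test provides the bound
  \<open>l - i\<close>; the others keep their in-degree. A set disjoint from the enlarged
  arborescence avoids \<open>h e\<close>, so its strict bound persists too.\<close>

lemma growth_inv_accept:
  assumes inv: "growth_inv n m r l t h i u c x" and e: "acceptable n m r l t h i u x e"
    and he: "h e < n" and i: "i \<le> l"
  shows "growth_inv n m r l t h i (u(e := 1)) (c(e := i)) (x(h e := i + 1))" (is "growth_inv _ _ _ _ _ _ _ ?u ?c ?x")
    and "stamped n (x(h e := i + 1)) i = insert (h e) (stamped n x i)"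
proof -
  let ?X = "stamped n x i"
  show x: "stamped n ?x i = insert (h e) ?X" using he by (auto simp: stamped_def)
  have e': "e \<in> unused m u" "t e \<in> ?X" using e by (auto simp: acceptable_def)
  have u: "unused m ?u = unused m u - {e}" using e' by (auto simp: unused_def)
  have same: "indeg t h (unused m u - {e}) U = indeg t h (unused m u) U" if "h e \<notin> U" for U
    using indeg_remove_arc[OF finite_unused e'(1), of t h U] that by simp
  have mono: "color_class t h m u c j \<subseteq> color_class t h m ?u ?c j" for j
    using e' by (auto simp: color_class_def unused_def)
  have rtrancl: "(r, v) \<in> (color_class t h m ?u ?c j)\<^sup>*" if "(r, v) \<in> (color_class t h m u c j)\<^sup>*" for v j
    by (rule subsetD[OF rtrancl_mono[OF mono] that])
  have "e < m" using e' by (simp add: unused_def)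
  have "(t e, h e) \<in> color_class t h m ?u ?c i"
    unfolding color_class_def by (rule CollectI, rule exI[of _ e]) (simp add: \<open>e < m\<close>)
  moreover have "(r, t e) \<in> (color_class t h m ?u ?c i)\<^sup>*"
    using inv e' by (intro rtrancl) (simp add: growth_inv_def)
  ultimately have new: "(r, h e) \<in> (color_class t h m ?u ?c i)\<^sup>*"
    by (rule rtrancl_into_rtrancl[rotated])
  have "(r, v) \<in> (color_class t h m ?u ?c i)\<^sup>*" if "v \<in> ?X" for v
    using inv that by (intro rtrancl) (simp add: growth_inv_def)
  with new have "\<forall>v\<in>insert (h e) ?X. (r, v) \<in> (color_class t h m ?u ?c i)\<^sup>*"
    by simp
  moreover have "(r, v) \<in> (color_class t h m ?u ?c j)\<^sup>*" if "j < i" "v < n" for j v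
    using inv that by (intro rtrancl) (simp add: growth_inv_def)
  moreover have "l - i \<le> indeg t h (unused m u - {e}) U" if "U \<noteq> {}" "U \<subseteq> {..<n}" "r \<notin> U" for U
    using inv e same[of U] that unfolding growth_inv_def acceptable_def by (cases "h e \<in> U") auto
  moreover have "l - i < indeg t h (unused m u - {e}) U"
    if "U \<noteq> {}" "U \<subseteq> {..<n}" "U \<inter> insert (h e) ?X = {}" for U
    using inv same[of U] that unfolding growth_inv_def by auto
  ultimately show "growth_inv n m r l t h i ?u ?c ?x"
    using inv i unfolding growth_inv_def u x by auto
qed

text \<open>A pass that added no vertex leaves no acceptable arc at all, and
  \<open>exchange_arc\<close> then forces the arborescence to span.\<close>

lemma pass_inv_Suc:
  assumes inv: "try_inv n m r l t h i p m u c x" and ends: "\<forall>a<m. t a < n \<and> h a < n"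
  shows "pass_inv n m r l t h i (Suc p) u c x"
proof -
  let ?X = "stamped n x i"
  have growth: "growth_inv n m r l t h i u c x" using inv by (simp add: try_inv_def)
  have "?X = {..<n}" if none: "\<forall>a<m. \<not> acceptable n m r l t h i u x a"
  proof (rule ccontr)
    assume X: "?X \<noteq> {..<n}"
    obtain e where "e \<in> unused m u" "t e \<in> ?X" "h e \<notin> ?X"
      "\<And>U. U \<subseteq> {..<n} \<Longrightarrow> h e \<in> U \<Longrightarrow> r \<notin> U \<Longrightarrow> l - i \<le> indeg t h (unused m u - {e}) U"
    proof (rule exchange_arc[of "unused m u" t "{..<n}" h ?X r "l - i"])
      show "\<forall>e\<in>unused m u. t e \<in> {..<n} \<and> h e \<in> {..<n}" using ends by (auto simp: unused_def)
      show "?X \<subseteq> {..<n}" by (auto simp: stamped_def)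
      show "r \<in> ?X" using growth by (simp add: growth_inv_def)
    qed (use growth X in \<open>auto simp: growth_inv_def\<close>)
    with none show False by (auto simp: acceptable_def unused_def)
  qed
  with inv growth show ?thesis by (auto simp: try_inv_def pass_inv_def)
qed

lemma pass_inv_complete:
  assumes "pass_inv n m r l t h i n u c x"
  shows "stamped n x i = {..<n}"
proof -
  have "stamped n x i \<subseteq> {..<n}" by (auto simp: stamped_def)
  then show ?thesis using assms card_mono[of "{..<n}" "stamped n x i"] by (auto simp: pass_inv_def)
qed

lemma try_inv_accept:
  assumes inv: "try_inv n m r l t h i p e u c x" and e: "acceptable n m r l t h i u x e"
    and he: "h e < n" and i: "i \<le> l"
  shows "try_inv n m r l t h i p (Suc e) (u(e := 1)) (c(e := i)) (x(h e := i + 1))"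
proof -
  have "growth_inv n m r l t h i u c x" using inv by (simp add: try_inv_def)
  note new = growth_inv_accept[OF this e he i]
  have "h e \<notin> stamped n x i" using e by (simp add: acceptable_def)
  with he have "stamped n x i \<noteq> {..<n}" by auto
  then have "p + 1 \<le> card (stamped n x i)" using inv by (auto simp: try_inv_def)
  then have "p + 2 \<le> card (stamped n (x(h e := i + 1)) i)"
    unfolding new(2) using \<open>h e \<notin> stamped n x i\<close> by simp
  with new(1) show ?thesis by (simp add: try_inv_def)
qed

lemma try_inv_reject:
  assumes "try_inv n m r l t h i p e u c x" "\<not> acceptable n m r l t h i u x e"
  shows "try_inv n m r l t h i p (Suc e) u c x"
  using assms by (auto simp: try_inv_def less_Suc_eq)

section \<open>The coloring program\<close>

definition try_arc :: com where
  "try_arc =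
    Cond (Conj (Equal (At ''used'' ''e'') (Const 0))
         (Conj (Equal (Cell ''X'' (At ''tail'' ''e'')) (Plus (Var ''i'') (Const 1)))
               (Neg (Equal (Cell ''X'' (At ''head'' ''e'')) (Plus (Var ''i'') (Const 1))))))
      (Seq (Set_Var ''y'' (At ''head'' ''e''))
      (Seq test_arc
        (Cond (Equal (Var ''ok'') (Const 1))
          (Seq (Assign ''used'' (Var ''e'') (Const 1))
          (Seq (Assign ''color'' (Var ''e'') (Var ''i''))
               (Assign ''X'' (At ''head'' ''e'') (Plus (Var ''i'') (Const 1)))))
          Skip)))
      Skip"

lemma mods_try_arc: "mods try_arc = mods test_arc \<union> {''y'', ''used'', ''color'', ''X''}"
  by (auto simp: try_arc_def)

definition try_cost :: "nat \<Rightarrow> nat" where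
  "try_cost z = test_cost z + 200"

lemma run_try_arc:
  assumes s: "s ''vertices'' 0 = n" "s ''arcs'' 0 = m" "s ''root'' 0 = r"
      "s ''e'' 0 = e" "s ''level'' 0 = l" "s ''i'' 0 = i"
    and bounds: "r < n" "e < m" "i \<le> l" and z: "n \<le> z" "m \<le> z" "l \<le> z"
    and t: "\<And>a. a < m \<Longrightarrow> s ''tail'' a = t a \<and> s ''head'' a = h a"
    and ends: "\<forall>a<m. t a < n \<and> h a < n"
    and inv: "try_inv n m r l t h i p e (s ''used'') (s ''color'') (s ''X'')"
  shows "run try_arc s (try_cost z)
    (\<lambda>s'. try_inv n m r l t h i p (Suc e) (s' ''used'') (s' ''color'') (s' ''X''))" (is "run _ _ _ ?Q")
  unfolding try_arc_def
proof (rule run_Cond)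
  let ?b = "Conj (Equal (At ''used'' ''e'') (Const 0))
         (Conj (Equal (Cell ''X'' (At ''tail'' ''e'')) (Plus (Var ''i'') (Const 1)))
               (Neg (Equal (Cell ''X'' (At ''head'' ''e'')) (Plus (Var ''i'') (Const 1)))))"
  {
    assume "\<not> bval ?b s"
    then have "\<not> acceptable n m r l t h i (s ''used'') (s ''X'') e"
      using s t bounds ends by (auto simp: acceptable_def unused_def stamped_def)
    from try_inv_reject[OF inv this] show "run Skip s (test_cost z + 100) ?Q"
      by (intro run_loop_free) auto
  next
    assume b: "bval ?b s"
    let ?d = "Cond (Equal (Var ''ok'') (Const 1))
          (Seq (Assign ''used'' (Var ''e'') (Const 1))
          (Seq (Assign ''color'' (Var ''e'') (Var ''i''))
               (Assign ''X'' (At ''head'' ''e'') (Plus (Var ''i'') (Const 1)))))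
          Skip"
    show "run (Seq (Set_Var ''y'' (At ''head'' ''e'')) (Seq test_arc ?d)) s (test_cost z + 100) ?Q"
    proof (rule run_Seq)
      show "run (Set_Var ''y'' (At ''head'' ''e'')) s 10 (\<lambda>s'. s' ''y'' 0 = h e)"
        using s t bounds by (intro run_loop_free) auto
      fix s1 :: store
      assume a1: "agree_off (mods (Set_Var ''y'' (At ''head'' ''e''))) s s1" and y: "s1 ''y'' 0 = h e"
      have s1: "s1 ''vertices'' 0 = n" "s1 ''arcs'' 0 = m" "s1 ''root'' 0 = r"
          "s1 ''e'' 0 = e" "s1 ''level'' 0 = l" "s1 ''i'' 0 = i"
        using s a1 by (auto simp: agree_off_def)
      have t1: "s1 ''tail'' a = t a \<and> s1 ''head'' a = h a" if "a < m" for a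
        using t[OF that] a1 by (auto simp: agree_off_def)
      have he: "h e < n" using ends bounds by simp
      show "run (Seq test_arc ?d) s1 (test_cost z + 80) ?Q"
      proof (rule run_Seq[OF run_test_arc[OF s1(1-3) y s1(4) refl s1(5,6) bounds(1) he z t1 ends]])
        fix s2 :: store
        assume a2: "agree_off (mods test_arc) s1 s2"
          and ok: "s2 ''ok'' 0 = 1 \<longleftrightarrow> (\<forall>U \<subseteq> {..<n}. h e \<in> U \<longrightarrow> r \<notin> U \<longrightarrow>
            l - i \<le> indeg t h (unused m (s1 ''used'') - {e}) U)"
        have s2: "s2 ''e'' 0 = e" "s2 ''i'' 0 = i" "s2 ''used'' = s ''used''" "s2 ''color'' = s ''color''"
            "s2 ''X'' = s ''X''" "s2 ''head'' e = h e"
          using s a1 a2 t bounds by (auto simp: agree_off_def mods_test_arc)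
        have "s2 ''ok'' 0 = 1 \<longleftrightarrow> acceptable n m r l t h i (s ''used'') (s ''X'') e"
          using ok b s t bounds ends a1
          by (auto simp: acceptable_def unused_def stamped_def agree_off_def)
        then show "run ?d s2 70 ?Q"
          using try_inv_accept[OF inv _ he bounds(3)] try_inv_reject[OF inv] s2
          by (intro run_loop_free) auto
      qed simp_all
    qed simp
  }
qed (simp add: try_cost_def)

definition grow :: com where
  "grow =
    Seq (Assign ''X'' (Var ''root'') (Plus (Var ''i'') (Const 1)))
    (For ''pass'' (Var ''vertices'') (For ''e'' (Var ''arcs'') try_arc))"

lemma mods_grow: "mods grow = insert ''pass'' (insert ''e'' (mods try_arc))"
  by (auto simp: grow_def mods_try_arc)

definition grow_cost :: "nat \<Rightarrow> nat" where
  "grow_cost z = 10 + for_cost z (for_cost z (try_cost z))"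

lemma run_grow:
  assumes s: "s ''vertices'' 0 = n" "s ''arcs'' 0 = m" "s ''root'' 0 = r"
      "s ''level'' 0 = l" "s ''i'' 0 = i"
    and bounds: "r < n" "i \<le> l" and z: "n \<le> z" "m \<le> z" "l \<le> z"
    and t: "\<And>a. a < m \<Longrightarrow> s ''tail'' a = t a \<and> s ''head'' a = h a"
    and ends: "\<forall>a<m. t a < n \<and> h a < n"
    and inv: "packing_inv n m r l t h i (s ''used'') (s ''color'') (s ''X'')"
  shows "run grow s (grow_cost z)
    (\<lambda>s'. packing_inv n m r l t h (Suc i) (s' ''used'') (s' ''color'') (s' ''X''))" (is "run _ _ _ ?Q")
  unfolding grow_def
proof (rule run_Seq)
  let ?pass = "\<lambda>p s'. pass_inv n m r l t h i p (s' ''used'') (s' ''color'') (s' ''X'')"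
  let ?try = "\<lambda>p e s'. try_inv n m r l t h i p e (s' ''used'') (s' ''color'') (s' ''X'')"
  let ?init = "Assign ''X'' (Var ''root'') (Plus (Var ''i'') (Const 1))"
  have "r \<in> stamped n ((s ''X'')(r := i + 1)) i" using bounds by (simp add: stamped_def)
  then have "1 \<le> card (stamped n ((s ''X'')(r := i + 1)) i)"
    by (metis One_nat_def Suc_leI card_gt_0_iff empty_iff finite_stamped)
  with growth_inv_start[OF inv bounds] s show "run ?init s 10 (?pass 0)"
    by (intro run_loop_free) (auto simp: pass_inv_def)
  fix s1 :: store
  assume a1: "agree_off (mods ?init) s s1" and inv1: "?pass 0 s1"
  have s1: "s1 ''vertices'' 0 = n" "s1 ''arcs'' 0 = m" "s1 ''root'' 0 = r"
      "s1 ''level'' 0 = l" "s1 ''i'' 0 = i" "s1 ''tail'' = s ''tail''" "s1 ''head'' = s ''head''"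
    using s a1 by (auto simp: agree_off_def)
  show "run (For ''pass'' (Var ''vertices'') (For ''e'' (Var ''arcs'') try_arc)) s1
    (for_cost z (for_cost z (try_cost z))) ?Q"
  proof (rule run_For[where J = ?pass and N = n and z = z])
    fix p and s2 :: store
    assume p: "?pass p s2" and a2: "agree_off (insert ''pass'' (mods (For ''e'' (Var ''arcs'') try_arc))) s1 s2"
    show "run (For ''e'' (Var ''arcs'') try_arc) s2 (for_cost z (try_cost z)) (?pass (Suc p))"
    proof (rule run_For[where J = "?try p" and N = m and z = z])
      fix e and s3 :: store
      assume e: "e < m" "s3 ''e'' 0 = e" "?try p e s3" and a3: "agree_off (insert ''e'' (mods try_arc)) s2 s3"
      have s3: "s3 ''vertices'' 0 = n" "s3 ''arcs'' 0 = m" "s3 ''root'' 0 = r"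
          "s3 ''level'' 0 = l" "s3 ''i'' 0 = i" "s3 ''tail'' = s ''tail''" "s3 ''head'' = s ''head''"
        using s1 a2 a3 by (auto simp: agree_off_def mods_try_arc mods_test_arc)
      show "run try_arc s3 (try_cost z) (?try p (Suc e))"
        by (rule run_try_arc[OF s3(1-3) e(2) s3(4,5) bounds(1) e(1) bounds(2) z _ ends e(3)])
          (use s3 t in simp)
    next
      fix s3 :: store
      assume "?try p m s3"
      then show "?pass (Suc p) s3" using ends by (rule pass_inv_Suc)
    qed (use s1 a2 z p in \<open>auto simp: agree_off_def mods_try_arc mods_test_arc try_inv_def pass_inv_def\<close>)
  next
    fix s2 :: store
    assume p: "?pass n s2"
    from pass_inv_complete[OF p] p bounds(2) show "?Q s2"
      by (intro packing_inv_Suc) (auto simp: pass_inv_def)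
  qed (use s1 z inv1 in \<open>auto simp: agree_off_def mods_try_arc mods_test_arc\<close>)
qed (simp add: grow_cost_def)

definition pack_arborescences :: com where
  "pack_arborescences = For ''i'' (Plus (Var ''level'') (Const 1)) grow"

lemma run_pack_arborescences:
  assumes s: "s ''vertices'' 0 = n" "s ''arcs'' 0 = m" "s ''root'' 0 = r" "s ''level'' 0 = l"
    and r: "r < n" and z: "n \<le> z" "m \<le> z" "l + 1 \<le> z"
    and t: "\<And>a. a < m \<Longrightarrow> s ''tail'' a = t a \<and> s ''head'' a = h a"
    and ends: "\<forall>a<m. t a < n \<and> h a < n"
    and inv: "packing_inv n m r l t h 0 (s ''used'') (s ''color'') (s ''X'')"
  shows "run pack_arborescences s (for_cost z (grow_cost z))
    (\<lambda>s'. packing_inv n m r l t h (l + 1) (s' ''used'') (s' ''color'') (s' ''X''))"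
  unfolding pack_arborescences_def
proof (rule run_For[where J = "\<lambda>i s'. packing_inv n m r l t h i (s' ''used'') (s' ''color'') (s' ''X'')"
      and N = "l + 1" and z = z])
  fix i and s1 :: store
  assume i: "i < l + 1" "s1 ''i'' 0 = i"
    "packing_inv n m r l t h i (s1 ''used'') (s1 ''color'') (s1 ''X'')"
    and a1: "agree_off (insert ''i'' (mods grow)) s s1"
  have s1: "s1 ''vertices'' 0 = n" "s1 ''arcs'' 0 = m" "s1 ''root'' 0 = r"
      "s1 ''level'' 0 = l" "s1 ''tail'' = s ''tail''" "s1 ''head'' = s ''head''"
    using s a1 by (auto simp: agree_off_def mods_grow mods_try_arc mods_test_arc)
  have "i \<le> l" "l \<le> z" using i z by auto
  then show "run grow s1 (grow_cost z)
      (\<lambda>s'. packing_inv n m r l t h (Suc i) (s' ''used'') (s' ''color'') (s' ''X''))"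
    using run_grow[OF s1(1-4) i(2) r _ z(1,2) _ _ ends i(3)] s1 t by simp
qed (use s z inv in \<open>auto simp: agree_off_def mods_grow mods_try_arc mods_test_arc\<close>)

section \<open>Polynomial time bound and correctness of the coloring\<close>

definition poly_function :: "(nat \<Rightarrow> nat) \<Rightarrow> bool" where
  "poly_function f \<longleftrightarrow> (\<exists>q. \<forall>z. poly q z = f z)"

lemma poly_function_const: "poly_function (\<lambda>z. k)"
  unfolding poly_function_def by (rule exI[of _ "[:k:]"]) simp

lemma poly_function_id: "poly_function (\<lambda>z. z)"
  unfolding poly_function_def by (rule exI[of _ "[:0, 1:]"]) simp

lemma poly_function_add: "poly_function f \<Longrightarrow> poly_function g \<Longrightarrow> poly_function (\<lambda>z. f z + g z)"
  unfolding poly_function_def by (metis poly_add)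

lemma poly_function_mult: "poly_function f \<Longrightarrow> poly_function g \<Longrightarrow> poly_function (\<lambda>z. f z * g z)"
  unfolding poly_function_def by (metis poly_mult)

lemma poly_function_cost: "poly_function (\<lambda>z. for_cost z (grow_cost z))"
  unfolding for_cost_def grow_cost_def try_cost_def test_cost_def augment_cost_def search_cost_def
  by (intro poly_function_add poly_function_mult poly_function_id poly_function_const)

text \<open>At most \<open>l\<close> deleted colors spare some color \<open>j\<close>, whose class
  connects \<open>r\<close> to everything. Arcs never accepted keep an arbitrary color in the range,
  which can only add arcs to the surviving digraph.\<close>

lemma packing_inv_color_avoiding:
  assumes D: "fin_digraph D" "verts D = {..<n}" "arcs D = {..<m}" and r: "r < n"
    and inv: "packing_inv n m r l (tail D) (head D) (l + 1) u c x"
  shows "arc_color_avoiding_rooted_1_connected l D r {..<l + 1} c"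
  unfolding arc_color_avoiding_rooted_1_connected_def
proof (intro conjI allI impI ballI)
  show "c ` arcs D \<subseteq> {..<l + 1}" using inv D by (auto simp: packing_inv_def less_Suc_eq_le)
  fix C' v assume C': "C' \<subseteq> {..<l + 1}" "card C' \<le> l" and v: "v \<in> verts D"
  interpret fin_digraph D by fact
  let ?H = "D\<lparr>arcs := {e \<in> arcs D. c e \<notin> C'}\<rparr>"
  interpret H: wf_digraph ?H by unfold_locales auto
  from C' have "C' \<noteq> {..<l + 1}" by auto
  with C'(1) obtain j where j: "j < l + 1" "j \<notin> C'" by blast
  then have "(r, v) \<in> (color_class (tail D) (head D) m u c j)\<^sup>*"
    using inv v D by (auto simp: packing_inv_def)
  moreover have "color_class (tail D) (head D) m u c j \<subseteq> {(tail ?H e, head ?H e) |e. e \<in> arcs ?H}"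
    using j D by (auto simp: color_class_def)
  ultimately have "(r, v) \<in> {(tail ?H e, head ?H e) |e. e \<in> arcs ?H}\<^sup>*"
    using rtrancl_mono by blast
  then show "\<exists>p. H.apath r p v" by (rule H.rtrancl_imp_apath) (use r D in simp)
qed simp

lemma run_pack_arborescences_input:
  assumes D: "numbered_digraph D" "rooted_arc_connected (l + 1) D r"
  defines "z \<equiv> digraph_size D"
  shows "run pack_arborescences (input_store l D r) (for_cost z (grow_cost z))
    (\<lambda>s. arc_color_avoiding_rooted_1_connected l D r {..<l + 1} (output_coloring s))"
proof -
  define n m where "n = card (verts D)" and "m = card (arcs D)"
  let ?s = "input_store l D r"
  interpret fin_digraph D using D by (simp add: numbered_digraph_def)
  have verts: "verts D = {..<n}" and arcs: "arcs D = {..<m}"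
    using D(1) unfolding numbered_digraph_def n_def m_def by blast+
  have "r \<in> verts D" using D(2) by (simp add: rooted_arc_connected_def)
  with verts have r: "r < n" by simp
  have ends: "\<forall>a<m. tail D a < n \<and> head D a < n"
  proof (intro allI impI)
    fix a assume "a < m"
    with arcs have "a \<in> arcs D" by simp
    then have "tail D a \<in> verts D" "head D a \<in> verts D" by simp_all
    with verts show "tail D a < n \<and> head D a < n" by simp
  qed
  have cut: "l + 1 \<le> indeg (tail D) (head D) (arcs D) U"
    if "U \<noteq> {}" "U \<subseteq> verts D" "r \<notin> U" for U
    by (rule rooted_arc_connected_indeg[OF fin_digraph D(2) that])
  \<comment> \<open>The program loops over \<open>l + 1\<close> colors, while
    \<open>digraph_size\<close> does not count the level; connectivity bounds it by the number of
    arcs, through the loops at a single vertex or through the cut around all vertices but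
    \<open>r\<close>.\<close>
  have "l + 1 \<le> m"
  proof (cases "n = 1")
    case True
    with D(2) n_def have "l + 1 \<le> card {e \<in> arcs D. tail D e = head D e}"
      by (auto simp: rooted_arc_connected_def)
    also have "\<dots> \<le> m" unfolding m_def by (rule card_mono) auto
    finally show ?thesis .
  next
    case False
    have "verts D \<noteq> {r}"
    proof
      assume "verts D = {r}"
      with False n_def show False by simp
    qed
    with \<open>r \<in> verts D\<close> have "verts D - {r} \<noteq> {}" by blast
    then have "l + 1 \<le> indeg (tail D) (head D) (arcs D) (verts D - {r})" by (intro cut) auto
    also have "\<dots> \<le> m" unfolding indeg_def m_def by (rule card_mono) auto
    finally show ?thesis .
  qed
  then have z: "n \<le> z" "m \<le> z" "l + 1 \<le> z" by (auto simp: z_def digraph_size_def n_def m_def)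
  have unused: "unused m (?s ''used'') = arcs D"
    using arcs by (auto simp: unused_def input_store_def)
  \<comment> \<open>All arrays outside the input are 0 at the start: every arc is uncolored, no
    vertex is stamped and no color is finished.\<close>
  have inv: "packing_inv n m r l (tail D) (head D) 0 (?s ''used'') (?s ''color'') (?s ''X'')"
    unfolding packing_inv_def unused using cut verts by (auto simp: input_store_def)
  have "run pack_arborescences ?s (for_cost z (grow_cost z)) (\<lambda>s'.
      packing_inv n m r l (tail D) (head D) (l + 1) (s' ''used'') (s' ''color'') (s' ''X''))"
  proof (rule run_pack_arborescences[OF _ _ _ _ r z _ ends inv])
    fix a assume "a < m"
    then have "a \<in> arcs D" using arcs by simp
    then show "?s ''tail'' a = tail D a \<and> ?s ''head'' a = head D a" by (simp add: input_store_def)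
  qed (simp_all add: input_store_def scalar_def n_def m_def)
  then show ?thesis unfolding output_coloring_def
  proof (rule run_weaken)
    fix s' :: store
    assume "packing_inv n m r l (tail D) (head D) (l + 1) (s' ''used'') (s' ''color'') (s' ''X'')"
    then show "arc_color_avoiding_rooted_1_connected l D r {..<l + 1} (s' ''color'')"
      by (rule packing_inv_color_avoiding[OF fin_digraph verts arcs r])
  qed simp
qed

theorem theorem3p15:
  shows "\<exists>(c :: com) (q :: nat poly). \<forall>(l :: nat) (D :: (nat, nat) pre_digraph) (r :: nat).
    numbered_digraph D \<longrightarrow> rooted_arc_connected (l + 1) D r \<longrightarrow>
    (\<exists>t s. exec c (input_store l D r) t s \<and>
       t \<le> poly q (digraph_size D) \<and>
       arc_color_avoiding_rooted_1_connected l D r {..<l + 1} (output_coloring s))"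
proof -
  obtain q where q: "\<And>z. poly q z = for_cost z (grow_cost z)"
    using poly_function_cost unfolding poly_function_def by blast
  show ?thesis
  proof (intro exI[of _ pack_arborescences] exI[of _ q] allI impI)
    fix l r :: nat and D :: "(nat, nat) pre_digraph"
    assume "numbered_digraph D" "rooted_arc_connected (l + 1) D r"
    from run_pack_arborescences_input[OF this]
    show "\<exists>t s. exec pack_arborescences (input_store l D r) t s \<and> t \<le> poly q (digraph_size D) \<and>
        arc_color_avoiding_rooted_1_connected l D r {..<l + 1} (output_coloring s)"
      unfolding run_def q .
  qed
qed

end
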